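(* Let $m,n\ge1$ with $\max\{m,n\}>1$. Then for every $c>0$ the set $\mathbb R^{m\times n}\setminus\operatorname{D}^\times_{m,n}(c\psi_1)$ has Lebesgue measure zero. Consequently the set $\operatorname{Sing}^\times_{m,n}:=\bigcap_{c>0}\operatorname{D}^\times_{m,n}(c\psi_1)$ has full Lebesgue measure.
   Context: For $Y\in\mathbb R^{m\times n}$ let $Y_1,\dots,Y_m$ be its rows. For $\boldsymbol x\in\mathbb R^n$ put $\Pi_+(\boldsymbol x):=\prod_{i=1}^n\max\{1,|x_i|\}$. For $\psi:[1,\infty)\to(0,\infty)$ and $T>1$ let $\mathcal S^\times_{m,n}(\psi,T)$ be the set of $Y\in\mathbb R^{m\times n}$ for which there exist $\boldsymbol p\in\mathbb Z^m$, $\boldsymbol q\in\mathbb Z^n\setminus\{\boldsymbol 0\}$ with $\prod_{i=1}^m|Y_i\boldsymbol q-p_i|<\psi(T)$ and $\Pi_+(\boldsymbol q)<T$. Put $\operatorname{D}^\times_{m,n}(\psi):=\bigcup_{T_0>1}\bigcap_{T\ge T_0}\mathcal S^\times_{m,n}(\psi,T)$, and $\psi_1(x):=1/x$. *)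

theory Defs
  imports "HOL-Analysis.Analysis"
begin

definition Pi_plus :: "real^'n \<Rightarrow> real" where
  "Pi_plus x = (\<Prod>i\<in>UNIV. max 1 \<bar>x $ i\<bar>)"

definition S_mult :: "(real \<Rightarrow> real) \<Rightarrow> real \<Rightarrow> (real^'n^'m) set" where
  "S_mult psi T = {Y. \<exists>(p::real^'m) (q::real^'n).
      (\<forall>i. p $ i \<in> \<int>) \<and> (\<forall>j. q $ j \<in> \<int>) \<and> q \<noteq> 0 \<and>
      (\<Prod>i\<in>UNIV. \<bar>(Y $ i) \<bullet> q - p $ i\<bar>) < psi T \<and> Pi_plus q < T}"

definition D_mult :: "(real \<Rightarrow> real) \<Rightarrow> (real^'n^'m) set" where
  "D_mult psi = (\<Union>T0\<in>{1<..}. \<Inter>T\<in>{T0..}. S_mult psi T)"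

definition psi1 :: "real \<Rightarrow> real" where
  "psi1 x = 1 / x"

definition Sing_mult :: "(real^'n^'m) set" where
  "Sing_mult = (\<Inter>c\<in>{0<..}. D_mult (\<lambda>x. c * psi1 x))"

end

(* Two coordinates suffice. If n > 1, use two entries y1, y2 of one row and integer vectors q
supported on them; if m > 1, use two entries of one column, which a transference argument
(a vector orthogonal to (q1, q2, p), found by pigeonhole) reduces to the same statement:
for almost every (y1, y2), every c > 0 and all large k there is (q1, q2) \<noteq> 0 with
max 1 |q1| * max 1 |q2| \<le> 2^k and q1 y1 + q2 y2 within c / 2^k of an integer.

For fixed k one looks at the boxes |q1| \<le> 2^(k-j), |q2| \<le> 2^j. Dirichlet's theorem gives an integer
vector with form at most 2^-k in each of them. Position j is good at (y1, y2) if that vector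
cannot have |q2| much smaller than 2^j. Then its form vanishes close to y2 and is below c / 2^k
on a fixed proportion of the dyadic interval of y2 that corresponds to j. So a point which is good
at r well separated positions and still fails lies in a set of measure at most (1 - 2^-K)^r.
A second moment estimate would give failure probability 1/k only, which is not summable.

If j and j+1 are both bad, two independent witnesses would combine to a solution, so on a run of bad
positions j, ..., j+L one witness (q1, q2) serves throughout. It satisfies |q1 q2| \<le> 2^(k-L), and
such points have measure O(k 2^-L). With L about sqrt k both bounds are summable and
the Borel-Cantelli lemma applies. *)
theory Submission
  imports Defs "HOL-Real_Asymp.Real_Asymp"
begin

section \<open>Short integer vectors\<close>

lemma pigeonhole_real:
  fixes f :: "'a \<Rightarrow> real"
  assumes "finite A" "n < card A" "\<And>x. x \<in> A \<Longrightarrow> 0 \<le> f x \<and> f x < real n"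
  shows "\<exists>x\<in>A. \<exists>y\<in>A. x \<noteq> y \<and> \<bar>f x - f y\<bar> < 1"
proof -
  have "(\<lambda>x. nat \<lfloor>f x\<rfloor>) ` A \<subseteq> {..<n}"
  proof (intro image_subsetI)
    fix x assume "x \<in> A"
    then have "\<lfloor>f x\<rfloor> < int n" "0 \<le> \<lfloor>f x\<rfloor>" using assms(3)[of x] by (simp_all add: floor_less_iff)
    then show "nat \<lfloor>f x\<rfloor> \<in> {..<n}" by (simp only: lessThan_iff nat_less_iff)
  qed
  then have "card ((\<lambda>x. nat \<lfloor>f x\<rfloor>) ` A) \<le> card {..<n}"
    by (intro card_mono) simp_all
  then have "\<not> inj_on (\<lambda>x. nat \<lfloor>f x\<rfloor>) A"
    using assms(2) by (intro pigeonhole) simp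
  then obtain x y where xy: "x \<in> A" "y \<in> A" "x \<noteq> y" "nat \<lfloor>f x\<rfloor> = nat \<lfloor>f y\<rfloor>"
    unfolding inj_on_def by blast
  then have "\<lfloor>f x\<rfloor> = \<lfloor>f y\<rfloor>"
    using assms(3)[of x] assms(3)[of y] by (simp add: nat_eq_iff)
  then have "\<bar>f x - f y\<bar> < 1" by linarith
  with xy show ?thesis by blast
qed

text \<open>Pigeonhole on the \<open>(X + 1) * (Z + 1) > M\<close> points of the box with
  nonnegative coordinates: the fractional parts of the form, scaled by \<open>M\<close>, lie in
  \<open>[0, M)\<close>, so two of them differ by less than 1. The difference of those two points is
  the vector sought.\<close>

lemma dirichlet_linear_form:
  fixes y1 y2 :: real
  assumes "M \<le> X * Z" "M > 0"
  shows "\<exists>q1 q2 p :: int. (q1 \<noteq> 0 \<or> q2 \<noteq> 0) \<and> \<bar>q1\<bar> \<le> int X \<and> \<bar>q2\<bar> \<le> int Z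
           \<and> \<bar>of_int q1 * y1 + of_int q2 * y2 + of_int p\<bar> < 1 / real M"
proof -
  let ?g = "\<lambda>(u, v). real u * y1 + real v * y2"
  let ?A = "{0..X} \<times> {0..Z}"
  have "M < card ?A" using assms(1) by (simp add: card_cartesian_product)
  moreover have "0 \<le> real M * frac (?g x) \<and> real M * frac (?g x) < real M" for x
    using assms(2) by (simp add: frac_lt_1)
  ultimately obtain x y where xy: "x \<in> ?A" "y \<in> ?A" "x \<noteq> y"
    "\<bar>real M * frac (?g x) - real M * frac (?g y)\<bar> < 1"
    using pigeonhole_real[of ?A M "\<lambda>x. real M * frac (?g x)"] by blast
  obtain u v u' v' where [simp]: "x = (u, v)" "y = (u', v')" by (cases x, cases y) auto
  have "\<bar>frac (?g x) - frac (?g y)\<bar> * real M < 1"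
    using xy(4) by (simp add: abs_mult flip: right_diff_distrib mult.commute)
  then have "\<bar>frac (?g x) - frac (?g y)\<bar> < 1 / real M"
    using assms(2) by (simp add: pos_less_divide_eq)
  moreover have "frac (?g x) - frac (?g y) = of_int (int u - int u') * y1 + of_int (int v - int v') * y2
      + of_int (\<lfloor>?g y\<rfloor> - \<lfloor>?g x\<rfloor>)"
    by (simp add: frac_def algebra_simps)
  moreover have "int u - int u' \<noteq> 0 \<or> int v - int v' \<noteq> 0" using xy(3) by auto
  moreover have "\<bar>int u - int u'\<bar> \<le> int X" "\<bar>int v - int v'\<bar> \<le> int Z" using xy(1,2) by auto
  ultimately show ?thesis by metis
qed

section \<open>Bad vectors and runs of bad positions\<close>

text \<open>The problem for one row and two columns at the dyadic parameter
  \<open>T = 2 ^ k\<close>, with the height allowed to equal \<open>2 ^ k\<close>. Arbitrary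
  \<open>T\<close> and the strict height bound are recovered in \<open>linear_form_uniform\<close>
  at the price of a factor 2 in \<open>c\<close>.\<close>

definition improvable_at :: "real \<Rightarrow> nat \<Rightarrow> real \<Rightarrow> real \<Rightarrow> bool" where
  "improvable_at c k y1 y2 \<longleftrightarrow> (\<exists>q1 q2 p :: int. (q1 \<noteq> 0 \<or> q2 \<noteq> 0)
     \<and> max 1 \<bar>q1\<bar> * max 1 \<bar>q2\<bar> \<le> 2 ^ k
     \<and> \<bar>of_int q1 * y1 + of_int q2 * y2 + of_int p\<bar> < c / 2 ^ k)"

text \<open>The box of position \<open>j\<close>, with its second side shortened by the factor
  \<open>2 ^ R\<close>. The 3 is used up in \<open>good_position_success\<close>: 1 for Dirichlet's
  vector at the midpoint of an interval, 2 for moving from there to another point of the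
  interval.\<close>

definition bad_vec :: "nat \<Rightarrow> nat \<Rightarrow> nat \<Rightarrow> real \<Rightarrow> real \<Rightarrow> int \<Rightarrow> int \<Rightarrow> int \<Rightarrow> bool" where
  "bad_vec R k j y1 y2 q1 q2 p \<longleftrightarrow> (q1 \<noteq> 0 \<or> q2 \<noteq> 0) \<and> \<bar>q1\<bar> \<le> 2 ^ (k - j) \<and> \<bar>q2\<bar> * 2 ^ R < 2 ^ j
     \<and> \<bar>of_int q1 * y1 + of_int q2 * y2 + of_int p\<bar> \<le> 3 / 2 ^ k"

lemma gcd3_mult_left:
  fixes u a b c :: int
  shows "gcd (u * a) (gcd (u * b) (u * c)) = \<bar>u\<bar> * gcd a (gcd b c)"
proof -
  have "gcd (u * a) (gcd (u * b) (u * c)) = gcd (u * a) (\<bar>u\<bar> * gcd b c)"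
    by (simp only: gcd_mult_distrib_int)
  also have "\<dots> = gcd (u * a) \<bar>u * gcd b c\<bar>" by (simp only: abs_mult abs_gcd_int)
  also have "\<dots> = gcd (u * a) (u * gcd b c)" by (rule gcd_abs2_int)
  also have "\<dots> = \<bar>u\<bar> * gcd a (gcd b c)" by (rule gcd_mult_distrib_int[symmetric])
  finally show ?thesis .
qed

text \<open>Division by the gcd of the whole triple only shrinks the coordinates and the form. The
  gcd includes \<open>p\<close> so that the constant term stays an integer.\<close>

lemma bad_vec_primitive:
  assumes "bad_vec R k j y1 y2 q1 q2 p"
  shows "\<exists>q1' q2' p'. bad_vec R k j y1 y2 q1' q2' p' \<and> coprime q1' (gcd q2' p')"
proof -
  define g where "g = gcd q1 (gcd q2 p)"
  have "gcd q1 (gcd q2 p) \<noteq> 0" using assms by (auto simp: bad_vec_def)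
  then have g: "g \<ge> 1" using gcd_ge_0_int[of q1 "gcd q2 p"] unfolding g_def by linarith
  have "g dvd q1" "g dvd q2" "g dvd p"
    unfolding g_def by (meson dvd_trans gcd_dvd1 gcd_dvd2)+
  then obtain a b e where abe: "q1 = g * a" "q2 = g * b" "p = g * e" unfolding dvd_def by blast
  have "gcd (g * a) (gcd (g * b) (g * e)) = g * gcd a (gcd b e)"
    unfolding gcd3_mult_left using g by simp
  then have "g * gcd a (gcd b e) = g"
    by (simp only: abe[symmetric] g_def[symmetric])
  then have prim: "coprime a (gcd b e)" using g by (simp add: coprime_iff_gcd_eq_1)
  have le: "\<bar>x\<bar> \<le> \<bar>g * x\<bar>" for x :: int
    using g mult_right_mono[of 1 g "\<bar>x\<bar>"] by (simp add: abs_mult)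
  have "\<bar>a\<bar> \<le> \<bar>q1\<bar>" "\<bar>b\<bar> \<le> \<bar>q2\<bar>" using le abe by auto
  moreover have "\<bar>of_int a * y1 + of_int b * y2 + of_int e\<bar>
      \<le> \<bar>of_int q1 * y1 + of_int q2 * y2 + of_int p\<bar>"
  proof -
    have "of_int q1 * y1 + of_int q2 * y2 + of_int p
        = of_int g * (of_int a * y1 + of_int b * y2 + of_int e)"
      by (simp add: abe algebra_simps)
    then show ?thesis
      using g mult_right_mono[of 1 "real_of_int g" "\<bar>of_int a * y1 + of_int b * y2 + of_int e\<bar>"]
      by (simp add: abs_mult)
  qed
  moreover have nz: "a \<noteq> 0 \<or> b \<noteq> 0" using assms abe by (auto simp: bad_vec_def)
  moreover have "\<bar>b\<bar> * 2 ^ R \<le> \<bar>q2\<bar> * 2 ^ R" using \<open>\<bar>b\<bar> \<le> \<bar>q2\<bar>\<close> by (intro mult_right_mono) auto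
  ultimately have "bad_vec R k j y1 y2 a b e"
    using assms nz unfolding bad_vec_def by (meson order.trans order.strict_trans1)
  with prim show ?thesis by blast
qed

text \<open>Two proportional triples have the same gcd up to sign, and for primitive triples these
  gcds are \<open>\<bar>u\<bar>\<close> and \<open>\<bar>v\<bar>\<close>.\<close>

lemma primitive_parallel:
  fixes u v q1 q2 p r1 r2 s :: int
  assumes "coprime q1 (gcd q2 p)" "coprime r1 (gcd r2 s)" "u \<noteq> 0 \<or> v \<noteq> 0"
    and "u * q1 + v * r1 = 0" "u * q2 + v * r2 = 0" "u * p + v * s = 0"
  shows "\<bar>u\<bar> = \<bar>v\<bar> \<and> u \<noteq> 0"
proof -
  have "\<bar>u\<bar> = gcd (u * q1) (gcd (u * q2) (u * p))"
    unfolding gcd3_mult_left using assms(1) by (simp add: coprime_iff_gcd_eq_1)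
  also have "\<dots> = gcd (v * r1) (gcd (v * r2) (v * s))"
  proof -
    have "u * q1 = - (v * r1)" "u * q2 = - (v * r2)" "u * p = - (v * s)" using assms by linarith+
    then show ?thesis by (simp only: gcd_neg1_int gcd_neg2_int)
  qed
  also have "\<dots> = \<bar>v\<bar>"
    unfolding gcd3_mult_left using assms(2) by (simp add: coprime_iff_gcd_eq_1)
  finally show ?thesis using assms(3) by auto
qed

text \<open>Two independent bad vectors at neighbouring positions span a plane lattice containing, by
  pigeonhole, a vector that witnesses \<open>improvable_at\<close>.\<close>

lemma adjacent_bad_vec:
  fixes B :: nat
  assumes c: "0 < c" "c \<le> 1" and B: "12 \<le> c * real B" "8 * B\<^sup>2 \<le> 2 ^ R"
    and i: "R \<le> i" "Suc i \<le> k" and fail: "\<not> improvable_at c k y1 y2"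
    and w: "bad_vec R k i y1 y2 q1 q2 p" "coprime q1 (gcd q2 p)"
    and w': "bad_vec R k (Suc i) y1 y2 r1 r2 s" "coprime r1 (gcd r2 s)"
  shows "bad_vec R k (Suc i) y1 y2 q1 q2 p"
proof -
  define L where "L = of_int q1 * y1 + of_int q2 * y2 + of_int p"
  define L' where "L' = of_int r1 * y1 + of_int r2 * y2 + of_int s"
  have L: "\<bar>L\<bar> \<le> 3 / 2 ^ k" "\<bar>L'\<bar> \<le> 3 / 2 ^ k"
    using w w' by (auto simp: bad_vec_def L_def L'_def)
  have B1: "B \<ge> 12"
  proof -
    have "c * real B \<le> 1 * real B" using c by (intro mult_right_mono) auto
    then show ?thesis using B by simp
  qed
  \<comment> \<open>Since \<open>\<bar>u * L + v * L'\<bar>\<close> is at most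
    \<open>6 * B / 2 ^ k\<close>, this scaling and shift put all values into
    \<open>[0, B\<^sup>2]\<close>, while there are \<open>(B + 1)\<^sup>2 > B\<^sup>2 + 1\<close>
    pairs. A collision makes a combination smaller than \<open>12 / (2 ^ k * B)\<close>, hence than
    \<open>c / 2 ^ k\<close>.\<close>
  define f where "f = (\<lambda>(u::nat, v::nat). (real u * L + real v * L') * 2 ^ k * real B / 12 + (real B)\<^sup>2 / 2)"
  let ?A = "{0..B} \<times> {0..B}"
  have "B\<^sup>2 + 1 < card ?A" using B1 by (simp add: card_cartesian_product power2_eq_square)
  moreover have "0 \<le> f x \<and> f x < real (B\<^sup>2 + 1)" if "x \<in> ?A" for x
  proof -
    obtain u v where x0: "x = (u, v)" by (cases x)
    then have x: "x = (u, v)" "u \<le> B" "v \<le> B" using that by simp_all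
    have "\<bar>real u * L + real v * L'\<bar> \<le> \<bar>real u * L\<bar> + \<bar>real v * L'\<bar>" by linarith
    also have "\<dots> \<le> real B * (3 / 2 ^ k) + real B * (3 / 2 ^ k)"
      unfolding abs_mult using x L by (intro add_mono mult_mono) auto
    finally have "\<bar>real u * L + real v * L'\<bar> * (2 ^ k * real B / 12)
        \<le> (6 * real B / 2 ^ k) * (2 ^ k * real B / 12)"
      by (intro mult_right_mono) auto
    also have "\<dots> = (real B)\<^sup>2 / 2" by (simp add: power2_eq_square)
    finally have "\<bar>(real u * L + real v * L') * (2 ^ k * real B / 12)\<bar> \<le> (real B)\<^sup>2 / 2"
      by (simp add: abs_mult)
    then show ?thesis unfolding x f_def by (auto simp: abs_le_iff field_simps)
  qed
  ultimately obtain x y where xy: "x \<in> ?A" "y \<in> ?A" "x \<noteq> y" "\<bar>f x - f y\<bar> < 1"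
    using pigeonhole_real[of ?A "B\<^sup>2 + 1" f] by blast
  obtain u1 v1 u2 v2 where [simp]: "x = (u1, v1)" "y = (u2, v2)" by (cases x, cases y) auto
  define u v where uv: "u = int u1 - int u2" "v = int v1 - int v2"
  have uv0: "u \<noteq> 0 \<or> v \<noteq> 0" using xy(3) by (auto simp: uv)
  have uvB: "\<bar>u\<bar> \<le> int B" "\<bar>v\<bar> \<le> int B" using xy by (auto simp: uv)
  have "f x - f y = (of_int u * L + of_int v * L') * (2 ^ k * real B / 12)"
    by (simp add: f_def uv field_simps)
  with xy(4) have "\<bar>of_int u * L + of_int v * L'\<bar> * (2 ^ k * real B / 12) < 1"
    by (simp add: abs_mult)
  then have "\<bar>of_int u * L + of_int v * L'\<bar> < 12 / (2 ^ k * real B)"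
    using B1 by (simp add: field_simps)
  also have "\<dots> \<le> c / 2 ^ k" using B(1) B1 by (simp add: field_simps)
  finally have small: "\<bar>of_int u * L + of_int v * L'\<bar> < c / 2 ^ k" .
  define t1 t2 t3 where t: "t1 = u * q1 + v * r1" "t2 = u * q2 + v * r2" "t3 = u * p + v * s"
  have Lt: "of_int u * L + of_int v * L' = of_int t1 * y1 + of_int t2 * y2 + of_int t3"
    by (simp add: t L_def L'_def algebra_simps)
  \<comment> \<open>Otherwise the combination itself would show that \<open>c\<close> is improvable
    at \<open>k\<close>: its coordinates are at most \<open>2 * B * 2 ^ (k - i)\<close> and
    \<open>4 * B * 2 ^ (i - R)\<close>, with product \<open>8 * B\<^sup>2 * 2 ^ (k - R)\<close>, and
    \<open>2 ^ R\<close> was chosen to absorb \<open>8 * B\<^sup>2\<close>.\<close>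
  have "t1 = 0 \<and> t2 = 0"
  proof (rule ccontr)
    assume nz: "\<not> (t1 = 0 \<and> t2 = 0)"
    define a b :: int where ab: "a = 2 ^ (k - i)" "b = 2 ^ (i - R)"
    have a2: "(2::int) ^ (k - Suc i) \<le> a" unfolding ab by (intro power_increasing) auto
    have iR: "(2::int) ^ i = b * 2 ^ R" using i by (simp add: ab flip: power_add)
    have bnd: "\<bar>q1\<bar> \<le> a" "\<bar>r1\<bar> \<le> a" "\<bar>q2\<bar> \<le> b" "\<bar>r2\<bar> \<le> 2 * b"
    proof -
      show "\<bar>q1\<bar> \<le> a" "\<bar>r1\<bar> \<le> a"
        using w w' a2 order.trans unfolding bad_vec_def ab by blast+
      have "\<bar>q2\<bar> * 2 ^ R < b * 2 ^ R" "\<bar>r2\<bar> * 2 ^ R < (2 * b) * 2 ^ R"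
        using w w' iR by (auto simp: bad_vec_def)
      then show "\<bar>q2\<bar> \<le> b" "\<bar>r2\<bar> \<le> 2 * b"
        by (auto simp: mult_less_cancel_right)
    qed
    have "\<bar>t1\<bar> \<le> \<bar>u\<bar> * \<bar>q1\<bar> + \<bar>v\<bar> * \<bar>r1\<bar>" unfolding t abs_mult[symmetric] by linarith
    also have "\<dots> \<le> int B * a + int B * a"
      using bnd uvB by (intro add_mono mult_mono) auto
    finally have t1: "\<bar>t1\<bar> \<le> 2 * int B * a" by (simp add: mult_ac)
    have "\<bar>t2\<bar> \<le> \<bar>u\<bar> * \<bar>q2\<bar> + \<bar>v\<bar> * \<bar>r2\<bar>" unfolding t abs_mult[symmetric] by linarith
    also have "\<dots> \<le> int B * b + int B * (2 * b)"
      using bnd uvB by (intro add_mono mult_mono) auto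
    also have "\<dots> \<le> 4 * int B * b" using ab by simp
    finally have t2: "\<bar>t2\<bar> \<le> 4 * int B * b" by simp
    have ge1: "1 \<le> 2 * int B * a" "1 \<le> 4 * int B * b"
      using B1 by (simp_all add: ab int_one_le_iff_zero_less)
    have "max 1 \<bar>t1\<bar> * max 1 \<bar>t2\<bar> \<le> (2 * int B * a) * (4 * int B * b)"
      using t1 t2 ge1 by (intro mult_mono max.boundedI) linarith+
    also have "\<dots> = int (8 * B\<^sup>2) * (a * b)" by (simp add: power2_eq_square)
    also have "\<dots> \<le> int (2 ^ R) * (a * b)"
      using B(2) by (intro mult_right_mono) (auto simp: ab simp del: of_nat_power of_nat_mult)
    also have "\<dots> = 2 ^ k" using i by (simp add: ab flip: power_add)
    finally have "max 1 \<bar>t1\<bar> * max 1 \<bar>t2\<bar> \<le> 2 ^ k" .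
    with small nz Lt fail show False unfolding improvable_at_def by auto
  qed
  \<comment> \<open>With the first two coordinates zero, the form reduces to the integer
    \<open>t3\<close>, whose absolute value is below \<open>c / 2 ^ k \<le> 1\<close>.\<close>
  moreover from this have "t3 = 0"
  proof -
    have "\<bar>real_of_int t3\<bar> < c / 2 ^ k" using small Lt \<open>t1 = 0 \<and> t2 = 0\<close> by simp
    also have "\<dots> \<le> 1" using c one_le_power[of "2::real" k] by (simp add: divide_le_eq order_trans)
    finally show ?thesis by linarith
  qed
  \<comment> \<open>The two triples are parallel and primitive, so they agree up to sign. The first
    witness thus inherits the size bounds of the second.\<close>
  ultimately have par: "\<bar>u\<bar> = \<bar>v\<bar>" "u \<noteq> 0"
    using primitive_parallel[OF w(2) w'(2) uv0] by (auto simp: t)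
  have abs_eq: "\<bar>x\<bar> = \<bar>y\<bar>" if "u * x + v * y = 0" for x y
  proof -
    have "\<bar>u * x\<bar> = \<bar>v * y\<bar>" using that by linarith
    then show ?thesis using par by (auto simp: abs_mult)
  qed
  have "\<bar>q1\<bar> = \<bar>r1\<bar>" "\<bar>q2\<bar> = \<bar>r2\<bar>"
    using \<open>t1 = 0 \<and> t2 = 0\<close> abs_eq unfolding t by blast+
  then show ?thesis using w(1) w'(1) unfolding bad_vec_def by simp
qed

text \<open>Start with a primitive witness at \<open>j\<close> and push it along with
  \<open>adjacent_bad_vec\<close>, one position at a time. Primitivity is carried through the
  induction because each step requires it again. The surviving vector satisfies the bound on
  \<open>q2\<close> from the first box and the bound on \<open>q1\<close> from the last.\<close>

lemma bad_run:
  fixes B :: nat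
  assumes c: "0 < c" "c \<le> 1" and B: "12 \<le> c * real B" "8 * B\<^sup>2 \<le> 2 ^ R"
    and j: "R \<le> j" "j + L \<le> k" and fail: "\<not> improvable_at c k y1 y2"
    and bad: "\<And>i. j \<le> i \<Longrightarrow> i \<le> j + L \<Longrightarrow> \<exists>q1 q2 p. bad_vec R k i y1 y2 q1 q2 p"
  shows "\<exists>q1 q2 p. bad_vec R k j y1 y2 q1 q2 p \<and> bad_vec R k (j + L) y1 y2 q1 q2 p"
proof -
  have "d \<le> L \<Longrightarrow> \<exists>q1 q2 p. coprime q1 (gcd q2 p) \<and>
     bad_vec R k j y1 y2 q1 q2 p \<and> bad_vec R k (j + d) y1 y2 q1 q2 p" for d
  proof (induction d)
    case 0
    then show ?case using bad[of j] bad_vec_primitive by fastforce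
  next
    case (Suc d)
    then obtain q1 q2 p where w: "coprime q1 (gcd q2 p)"
      "bad_vec R k j y1 y2 q1 q2 p" "bad_vec R k (j + d) y1 y2 q1 q2 p" by auto
    obtain r1 r2 s where w': "bad_vec R k (Suc (j + d)) y1 y2 r1 r2 s" "coprime r1 (gcd r2 s)"
      using bad[of "Suc (j + d)"] bad_vec_primitive Suc.prems
      by (metis add_Suc_right le_add1 nat_add_left_cancel_le)
    have "bad_vec R k (Suc (j + d)) y1 y2 q1 q2 p"
      by (rule adjacent_bad_vec[OF c B _ _ fail w(3,1) w']) (use j Suc.prems in auto)
    with w show ?case by auto
  qed
  then show ?thesis by blast
qed

section \<open>Avoiding the approximable points of a fibre\<close>

text \<open>The positions may depend on the point \<open>y\<close>. Recursion on the first of them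
  matches the descent through nested intervals in \<open>dyadic_avoidance\<close>.\<close>

primrec spaced :: "(nat \<Rightarrow> 'a \<Rightarrow> bool) \<Rightarrow> nat \<Rightarrow> nat \<Rightarrow> nat \<Rightarrow> nat \<Rightarrow> 'a \<Rightarrow> bool" where
  "spaced g K n 0 j y \<longleftrightarrow> True"
| "spaced g K n (Suc r) j y \<longleftrightarrow> (\<exists>i. j \<le> i \<and> i \<le> n \<and> g i y \<and> spaced g K n r (i + K) y)"

lemma spaced_antimono: "spaced g K n r j' y \<Longrightarrow> j \<le> j' \<Longrightarrow> spaced g K n r j y"
  by (cases r) (auto intro: order.trans)

lemma subdivide_interval:
  fixes a h y :: real
  assumes "a \<le> y" "y < a + h" "N > 0"
  shows "\<exists>i<N. a + real i * (h / real N) \<le> y \<and> y < a + real (Suc i) * (h / real N)"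
proof -
  have h: "h > 0" using assms by linarith
  define t where "t = (y - a) * real N / h"
  have t0: "0 \<le> t" unfolding t_def using assms h by simp
  have tN: "t < real N" unfolding t_def using assms h by (simp add: divide_less_eq)
  define i where "i = nat \<lfloor>t\<rfloor>"
  have i: "real i \<le> t" "t < real (Suc i)" using t0 unfolding i_def by linarith+
  have y: "y = a + t * (h / real N)" unfolding t_def using h assms(3) by simp
  have hN: "h / real N > 0" using h assms(3) by simp
  have "i < N" using i(1) tN by linarith
  moreover have "a + real i * (h / real N) \<le> y"
    using mult_right_mono[OF i(1), of "h / real N"] hN y by simp
  moreover have "y < a + real (Suc i) * (h / real N)"
    using mult_strict_right_mono[OF i(2) hN] y by simp
  ultimately show ?thesis by blast
qed

text \<open>The union bound for outer measure. Bounds are stated through measurable supersets, so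
  that sets cut out by \<open>spaced\<close> never have to be proved measurable.\<close>

lemma cover_UN:
  assumes "finite F" "0 \<le> e" "\<And>i. i \<in> F \<Longrightarrow> \<exists>A\<in>sets M. X i \<subseteq> A \<and> emeasure M A \<le> ennreal e"
    and "Y \<subseteq> (\<Union>i\<in>F. X i)" "real (card F) * e \<le> e'"
  shows "\<exists>A\<in>sets M. Y \<subseteq> A \<and> emeasure M A \<le> ennreal e'"
proof -
  obtain A where A: "\<And>i. i \<in> F \<Longrightarrow> A i \<in> sets M \<and> X i \<subseteq> A i \<and> emeasure M (A i) \<le> ennreal e"
    using assms(3) by metis
  have "emeasure M (\<Union>i\<in>F. A i) \<le> (\<Sum>i\<in>F. emeasure M (A i))"
    using A assms(1) by (intro emeasure_subadditive_finite) auto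
  also have "\<dots> \<le> (\<Sum>i\<in>F. ennreal e)" using A by (intro sum_mono) auto
  also have "\<dots> = ennreal (real (card F) * e)"
    using assms(2) by (simp add: ennreal_mult ennreal_of_nat_eq_real_of_nat)
  also have "\<dots> \<le> ennreal e'" using assms(5) by (rule ennreal_leI)
  finally have "emeasure M (\<Union>i\<in>F. A i) \<le> ennreal e'" .
  moreover have "(\<Union>i\<in>F. A i) \<in> sets M" using A assms(1) by (intro sets.finite_UN) auto
  moreover have "Y \<subseteq> (\<Union>i\<in>F. A i)" using assms(4) A by blast
  ultimately show ?thesis by blast
qed

text \<open>Each good position costs a proportion \<open>2\<^sup>-\<^sup>K\<close> of the dyadic interval around the point, and
  positions at distance at least \<open>K\<close> cost independently of each other.\<close>

lemma dyadic_avoidance: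
  fixes S :: "real set" and h0 :: real
  assumes h0: "h0 > 0" and K: "K > 0"
    and step: "\<And>j a y. j0 \<le> j \<Longrightarrow> j \<le> n \<Longrightarrow> a \<le> y \<Longrightarrow> y < a + h0 / 2 ^ j \<Longrightarrow> g j y \<Longrightarrow>
      \<exists>i<2 ^ K. {a + real i * (h0 / 2 ^ (j + K)) ..< a + real (Suc i) * (h0 / 2 ^ (j + K))} \<subseteq> S"
    and j: "j0 \<le> j"
  shows "\<exists>A\<in>sets lborel. {y. a \<le> y \<and> y < a + h0 / 2 ^ j \<and> y \<notin> S \<and> spaced g K n r j y} \<subseteq> A
           \<and> emeasure lborel A \<le> ennreal (h0 / 2 ^ j * (1 - 1 / 2 ^ K) ^ r)"
  using j
\<comment> \<open>Positions only increase, and beyond \<open>n\<close> no good position is left: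
  there the set is empty unless \<open>r = 0\<close>.\<close>
proof (induction "Suc n - j" arbitrary: j a r rule: less_induct)
  case less
  define Q where "Q = (\<lambda>a j r. {y. a \<le> y \<and> y < a + h0 / 2 ^ j \<and> y \<notin> S \<and> spaced g K n r j y})"
  define \<theta> where "\<theta> = 1 - 1 / (2::real) ^ K"
  have th: "0 \<le> \<theta>" by (simp add: \<theta>_def)
  have IH: "\<exists>A\<in>sets lborel. Q b j' s \<subseteq> A \<and> emeasure lborel A \<le> ennreal (h0 / 2 ^ j' * \<theta> ^ s)"
    if "j < j'" "j \<le> n" for b j' s
    using less.hyps[of j' b s] that less.prems unfolding Q_def \<theta>_def by fastforce
  have "\<exists>A\<in>sets lborel. Q a j r \<subseteq> A \<and> emeasure lborel A \<le> ennreal (h0 / 2 ^ j * \<theta> ^ r)"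
  proof (cases r)
    case 0
    have "Q a j r \<subseteq> {a..<a + h0 / 2 ^ j}" by (auto simp: Q_def)
    moreover have "emeasure lborel {a..<a + h0 / 2 ^ j} = ennreal (h0 / 2 ^ j * \<theta> ^ r)"
      using h0 0 by simp
    ultimately show ?thesis by (metis order_refl sets_lborel atLeastLessThan_borel)
  next
    case (Suc s)
    show ?thesis
    proof (cases "j \<le> n")
      case False
      then have "Q a j r = {}" by (auto simp: Q_def Suc)
      then show ?thesis by (intro bexI[of _ "{}"]) auto
    next
      case jn: True
      have sub: "\<exists>i<2 ^ d. a + real i * (h0 / 2 ^ (j + d)) \<le> y
           \<and> y < a + real (Suc i) * (h0 / 2 ^ (j + d))"
        if "a \<le> y" "y < a + h0 / 2 ^ j" for y d
        using subdivide_interval[OF that, of "2 ^ d"] by (simp add: power_add)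
      show ?thesis
      \<comment> \<open>One good point anywhere in the interval already places one of the
        \<open>2 ^ K\<close> subintervals inside \<open>S\<close>. The others are treated at
        position \<open>j + K\<close> with \<open>r\<close> lowered by one, which is legitimate for
        every point, whatever its own first position. If no point is good at \<open>j\<close>, every
        first position is later, and halving the interval keeps \<open>r\<close>.\<close>
      proof (cases "\<exists>y. a \<le> y \<and> y < a + h0 / 2 ^ j \<and> g j y")
        case True
        then obtain i0 where i0: "i0 < 2 ^ K"
          "{a + real i0 * (h0 / 2 ^ (j + K)) ..< a + real (Suc i0) * (h0 / 2 ^ (j + K))} \<subseteq> S"
          using step[of j a] jn less.prems by blast
        show ?thesis
        proof (rule cover_UN)
          show "finite ({..<2 ^ K} - {i0})" by simp
          show "0 \<le> h0 / 2 ^ (j + K) * \<theta> ^ s" using h0 th by simp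
          show "\<exists>A\<in>sets lborel. Q (a + real i * (h0 / 2 ^ (j + K))) (j + K) s \<subseteq> A
             \<and> emeasure lborel A \<le> ennreal (h0 / 2 ^ (j + K) * \<theta> ^ s)" for i
            using IH[of "j + K"] K jn by simp
          have "card ({..<2 ^ K} - {i0}) = 2 ^ K - 1" using i0(1) by simp
          then have "real (card ({..<2 ^ K} - {i0})) = 2 ^ K * \<theta>"
            by (simp add: \<theta>_def algebra_simps of_nat_diff)
          then show "real (card ({..<2 ^ K} - {i0})) * (h0 / 2 ^ (j + K) * \<theta> ^ s) \<le> h0 / 2 ^ j * \<theta> ^ r"
            by (simp add: Suc power_add mult_ac)
          show "Q a j r \<subseteq> (\<Union>i\<in>{..<2 ^ K} - {i0}. Q (a + real i * (h0 / 2 ^ (j + K))) (j + K) s)"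
          proof
            fix y assume y: "y \<in> Q a j r"
            then obtain i where i: "i < 2 ^ K" "a + real i * (h0 / 2 ^ (j + K)) \<le> y"
              "y < a + real (Suc i) * (h0 / 2 ^ (j + K))"
              using sub[of y K] unfolding Q_def by blast
            have "i \<noteq> i0"
            proof
              assume "i = i0"
              then have "y \<in> S" using i i0(2) by auto
              then show False using y unfolding Q_def by simp
            qed
            moreover have "spaced g K n s (j + K) y"
              using y spaced_antimono unfolding Q_def Suc by fastforce
            moreover have "y < a + real i * (h0 / 2 ^ (j + K)) + h0 / 2 ^ (j + K)"
              using i(3) by (simp only: of_nat_Suc distrib_right mult_1 add.assoc add.commute)
            ultimately show "y \<in> (\<Union>i\<in>{..<2 ^ K} - {i0}. Q (a + real i * (h0 / 2 ^ (j + K))) (j + K) s)"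
              using i y unfolding Q_def by blast
          qed
        qed
      next
        case False
        show ?thesis
        proof (rule cover_UN)
          show "finite {..<2 ^ 1 :: nat}" by simp
          show "0 \<le> h0 / 2 ^ (j + 1) * \<theta> ^ r" using h0 th by simp
          show "\<exists>A\<in>sets lborel. Q (a + real i * (h0 / 2 ^ (j + 1))) (j + 1) r \<subseteq> A
             \<and> emeasure lborel A \<le> ennreal (h0 / 2 ^ (j + 1) * \<theta> ^ r)" for i
            using IH[of "j + 1"] jn by simp
          show "real (card {..<2 ^ 1 :: nat}) * (h0 / 2 ^ (j + 1) * \<theta> ^ r) \<le> h0 / 2 ^ j * \<theta> ^ r"
            by simp
          show "Q a j r \<subseteq> (\<Union>i\<in>{..<2 ^ 1}. Q (a + real i * (h0 / 2 ^ (j + 1))) (j + 1) r)"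
          proof
            fix y assume y: "y \<in> Q a j r"
            then obtain i where i: "i < 2 ^ 1" "a + real i * (h0 / 2 ^ (j + 1)) \<le> y"
              "y < a + real (Suc i) * (h0 / 2 ^ (j + 1))"
              using sub[of y 1] unfolding Q_def by blast
            have "\<not> g j y" using y False unfolding Q_def by blast
            moreover obtain l where l: "j \<le> l" "l \<le> n" "g l y" "spaced g K n s (l + K) y"
              using y unfolding Q_def Suc by auto
            ultimately have "j + 1 \<le> l" by (metis Suc_eq_plus1 Suc_leI le_neq_implies_less)
            then have "spaced g K n r (j + 1) y" unfolding Suc using l by auto
            moreover have "y < a + real i * (h0 / 2 ^ (j + 1)) + h0 / 2 ^ (j + 1)"
              using i(3) by (simp only: of_nat_Suc distrib_right mult_1 add.assoc add.commute)
            ultimately show "y \<in> (\<Union>i\<in>{..<2 ^ 1}. Q (a + real i * (h0 / 2 ^ (j + 1))) (j + 1) r)"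
              using i y unfolding Q_def by blast
          qed
        qed
      qed
    qed
  qed
  then show ?case unfolding Q_def \<theta>_def .
qed

section \<open>Success on a fixed proportion of a dyadic interval\<close>

text \<open>Take Dirichlet's vector at the midpoint \<open>m\<close>. Were its \<open>q2\<close>
  short, it would be a bad vector at the good point \<open>y\<close>. So \<open>q2\<close> is large,
  the zero \<open>z\<close> of the form is close to \<open>m\<close>, and the form is small on the
  whole subinterval that contains \<open>z\<close>.\<close>

lemma good_position_success:
  assumes c: "4 * 2 ^ R \<le> c * 2 ^ K" and j: "R \<le> j" "j \<le> k"
    and y: "a \<le> y" "y < a + 4 * 2 ^ R / 2 ^ k / 2 ^ j"
    and good: "\<not> (\<exists>q1 q2 p. bad_vec R k j y1 y q1 q2 p)"
  shows "\<exists>i<2 ^ K. {a + real i * (4 * 2 ^ R / 2 ^ k / 2 ^ (j + K)) ..<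
           a + real (Suc i) * (4 * 2 ^ R / 2 ^ k / 2 ^ (j + K))} \<subseteq> {y. improvable_at c k y1 y}"
proof -
  \<comment> \<open>This length balances two requirements: moving by \<open>h / 2\<close> changes a
    form with \<open>\<bar>q2\<bar> \<le> 2 ^ j / 2 ^ R\<close> by at most \<open>2 / 2 ^ k\<close>,
    and for larger \<open>\<bar>q2\<bar>\<close> a value below \<open>1 / 2 ^ k\<close> at
    \<open>m\<close> puts the zero within \<open>h / 4\<close> of \<open>m\<close>.\<close>
  define h where "h = 4 * 2 ^ R / 2 ^ k / (2::real) ^ j"
  define m where "m = a + h / 2"
  have h: "h > 0" by (simp add: h_def)
  have jk: "(2::nat) ^ (k - j) * 2 ^ j = 2 ^ k" using j by (simp flip: power_add)
  obtain q1 q2 p :: int where q: "q1 \<noteq> 0 \<or> q2 \<noteq> 0" "\<bar>q1\<bar> \<le> 2 ^ (k - j)" "\<bar>q2\<bar> \<le> 2 ^ j"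
    and L: "\<bar>of_int q1 * y1 + of_int q2 * m + of_int p\<bar> < 1 / 2 ^ k"
    using dirichlet_linear_form[of "2 ^ k" "2 ^ (k - j)" "2 ^ j" y1 m] jk by auto
  define L where "L = of_int q1 * y1 + of_int q2 * m + of_int p"
  have ym: "\<bar>y - m\<bar> \<le> h / 2"
    using y unfolding m_def h_def[symmetric] abs_le_iff by linarith
  have q2: "2 ^ j \<le> \<bar>q2\<bar> * 2 ^ R"
  proof (rule ccontr)
    assume "\<not> ?thesis"
    then have lt: "\<bar>q2\<bar> * 2 ^ R < 2 ^ j" by simp
    then have "real_of_int (\<bar>q2\<bar> * 2 ^ R) < real_of_int (2 ^ j)" by (simp only: of_int_less_iff)
    then have "\<bar>real_of_int q2\<bar> * 2 ^ R \<le> 2 ^ j" by simp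
    then have "(\<bar>real_of_int q2\<bar> * 2 ^ R) * (2 / 2 ^ k / 2 ^ j) \<le> 2 ^ j * (2 / 2 ^ k / 2 ^ j)"
      by (rule mult_right_mono) simp
    then have "\<bar>real_of_int q2\<bar> * (h / 2) \<le> 2 / 2 ^ k"
      by (simp add: h_def mult_ac)
    moreover have "\<bar>of_int q2 * (y - m)\<bar> \<le> \<bar>real_of_int q2\<bar> * (h / 2)"
      unfolding abs_mult using ym by (intro mult_left_mono) auto
    moreover have "of_int q1 * y1 + of_int q2 * y + of_int p = L + of_int q2 * (y - m)"
      by (simp add: L_def algebra_simps)
    ultimately have "\<bar>of_int q1 * y1 + of_int q2 * y + of_int p\<bar> \<le> 1 / 2 ^ k + 2 / 2 ^ k"
      using L unfolding L_def[symmetric] by linarith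
    then have "\<bar>of_int q1 * y1 + of_int q2 * y + of_int p\<bar> \<le> 3 / 2 ^ k" by simp
    then have "bad_vec R k j y1 y q1 q2 p" using q lt by (simp add: bad_vec_def)
    with good show False by blast
  qed
  have q2r: "2 ^ j \<le> \<bar>real_of_int q2\<bar> * 2 ^ R"
  proof -
    have "real_of_int (2 ^ j) \<le> real_of_int (\<bar>q2\<bar> * 2 ^ R)" using q2 by (simp only: of_int_le_iff)
    then show ?thesis by simp
  qed
  have q20: "\<bar>real_of_int q2\<bar> > 0"
  proof -
    have "q2 \<noteq> 0" using q2 by auto
    then show ?thesis by simp
  qed
  define z where "z = m - L / of_int q2"
  have Lz: "of_int q1 * y1 + of_int q2 * z + of_int p = 0"
    using q20 by (simp add: z_def L_def field_simps)
  have "\<bar>z - m\<bar> = \<bar>L\<bar> / \<bar>real_of_int q2\<bar>" by (simp add: z_def abs_divide)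
  also have "\<dots> \<le> (1 / 2 ^ k) / (2 ^ j / 2 ^ R)"
    using L q20 q2r unfolding L_def[symmetric]
    by (intro frac_le) (auto simp: divide_le_eq)
  also have "\<dots> = h / 4" by (simp add: h_def)
  finally have zm: "\<bar>z - m\<bar> \<le> h / 4" .
  have "a \<le> z" "z < a + h" using zm h unfolding m_def abs_le_iff by linarith+
  then obtain i where i: "i < 2 ^ K" "a + real i * (h / 2 ^ K) \<le> z" "z < a + real (Suc i) * (h / 2 ^ K)"
    using subdivide_interval[of a z h "2 ^ K"] by auto
  have "improvable_at c k y1 x" if x: "a + real i * (h / 2 ^ K) \<le> x" "x < a + real (Suc i) * (h / 2 ^ K)" for x
  proof -
    have "\<bar>x - z\<bar> < h / 2 ^ K"
      using x i(2,3) unfolding abs_less_iff of_nat_Suc distrib_right mult_1 by linarith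
    then have "\<bar>real_of_int q2\<bar> * \<bar>x - z\<bar> < \<bar>real_of_int q2\<bar> * (h / 2 ^ K)"
      using q20 by (intro mult_strict_left_mono)
    also have "\<dots> \<le> 2 ^ j * (h / 2 ^ K)"
    proof -
      have "real_of_int \<bar>q2\<bar> \<le> real_of_int (2 ^ j)" using q(3) by (simp only: of_int_le_iff)
      then have "\<bar>real_of_int q2\<bar> \<le> 2 ^ j" by simp
      then show ?thesis using h by (intro mult_right_mono) auto
    qed
    also have "\<dots> = 4 * 2 ^ R / 2 ^ K / 2 ^ k" by (simp add: h_def)
    also have "\<dots> \<le> c / 2 ^ k" using c by (intro divide_right_mono) (simp_all add: divide_le_eq)
    also have "\<bar>real_of_int q2\<bar> * \<bar>x - z\<bar> = \<bar>of_int q1 * y1 + of_int q2 * x + of_int p\<bar>"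
    proof -
      have "of_int q1 * y1 + of_int q2 * x + of_int p = of_int q2 * (x - z)"
        using Lz by (simp add: algebra_simps)
      then show ?thesis by (simp add: abs_mult)
    qed
    finally have "\<bar>of_int q1 * y1 + of_int q2 * x + of_int p\<bar> < c / 2 ^ k" .
    moreover have "max 1 \<bar>q1\<bar> * max 1 \<bar>q2\<bar> \<le> 2 ^ (k - j) * 2 ^ j"
      using q by (intro mult_mono) (auto simp: max_def)
    ultimately show ?thesis
      using q(1) j unfolding improvable_at_def by (auto simp flip: power_add)
  qed
  moreover have "4 * 2 ^ R / 2 ^ k / 2 ^ (j + K) = h / 2 ^ K" by (simp add: h_def power_add)
  ultimately show ?thesis using i(1) by (intro exI[of _ i]) auto
qed

lemma fibre_cover:
  assumes c: "4 * 2 ^ R \<le> c * 2 ^ K" and K: "K > 0" and k: "R \<le> k" "2 \<le> k"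
  shows "\<exists>A\<in>sets lborel. {y. b \<le> y \<and> y < b + 1 \<and> \<not> improvable_at c k y1 y \<and>
       spaced (\<lambda>j y. \<not> (\<exists>q1 q2 p. bad_vec R k j y1 y q1 q2 p)) K k r R y} \<subseteq> A
     \<and> emeasure lborel A \<le> ennreal ((1 - 1 / 2 ^ K) ^ r)"
proof (rule cover_UN)
  let ?g = "\<lambda>j y. \<not> (\<exists>q1 q2 p. bad_vec R k j y1 y q1 q2 p)"
  \<comment> \<open>The interval length at the starting position \<open>R\<close> is
    \<open>4 / 2 ^ k\<close>, so exactly \<open>2 ^ (k - 2)\<close> such intervals tile the unit
    interval.\<close>
  define h where "h = 1 / real (2 ^ (k - 2))"
  have h: "4 * 2 ^ R / 2 ^ k / 2 ^ R = h"
  proof -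
    have "2 + (k - 2) = k" using k by simp
    then have "(2::real) ^ k = 2 ^ (2 + (k - 2))" by (simp only:)
    also have "\<dots> = 4 * 2 ^ (k - 2)" unfolding power_add by simp
    finally have "(2::real) ^ k = 4 * 2 ^ (k - 2)" .
    then show ?thesis by (simp add: h_def)
  qed
  define X where "X = (\<lambda>i::nat. {y. b + real i * h \<le> y \<and> y < b + real i * h + h \<and> y \<notin> {y. improvable_at c k y1 y}
      \<and> spaced ?g K k r R y})"
  show "finite {..<2 ^ (k - 2) :: nat}" by simp
  show "0 \<le> h * (1 - 1 / 2 ^ K) ^ r" by (simp add: h_def)
  show "\<exists>A\<in>sets lborel. X i \<subseteq> A \<and> emeasure lborel A \<le> ennreal (h * (1 - 1 / 2 ^ K) ^ r)" for i
    using dyadic_avoidance[of "4 * 2 ^ R / 2 ^ k" K R k ?g "{y. improvable_at c k y1 y}" R "b + real i * h" r]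
      good_position_success[OF c, of _ k] K
    unfolding h X_def by simp
  show "real (card {..<2 ^ (k - 2) :: nat}) * (h * (1 - 1 / 2 ^ K) ^ r) \<le> (1 - 1 / 2 ^ K) ^ r"
    by (simp add: h_def)
  show "{y. b \<le> y \<and> y < b + 1 \<and> \<not> improvable_at c k y1 y \<and> spaced ?g K k r R y} \<subseteq> (\<Union>i\<in>{..<2 ^ (k - 2)}. X i)"
  proof
    fix y assume y: "y \<in> {y. b \<le> y \<and> y < b + 1 \<and> \<not> improvable_at c k y1 y \<and> spaced ?g K k r R y}"
    then obtain i where i: "i < 2 ^ (k - 2)" "b + real i * h \<le> y" "y < b + real (Suc i) * h"
      using subdivide_interval[of b y 1 "2 ^ (k - 2)"] unfolding h_def by auto
    then have "y < b + real i * h + h"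
      unfolding of_nat_Suc distrib_right mult_1 by linarith
    with i y show "y \<in> (\<Union>i\<in>{..<2 ^ (k - 2)}. X i)" unfolding X_def by blast
  qed
qed

section \<open>Exceptional points left by long bad runs\<close>

text \<open>The trace of a bad run from \<open>j\<close> to \<open>j + L\<close>: the side for
  \<open>q1\<close> comes from the last box, the side for \<open>q2\<close> from the first. The
  factor \<open>2 ^ R\<close> is given away, since the saving that counts is
  \<open>\<bar>q1 * q2\<bar> \<le> 2 ^ (k - L)\<close>.\<close>

definition exceptional :: "nat \<Rightarrow> nat \<Rightarrow> real \<Rightarrow> real \<Rightarrow> bool" where
  "exceptional L k y1 y2 \<longleftrightarrow> (\<exists>j q1 q2 p. j + L \<le> k \<and> (q1 \<noteq> 0 \<or> q2 \<noteq> 0)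
     \<and> \<bar>q1\<bar> \<le> 2 ^ (k - (j + L)) \<and> \<bar>q2\<bar> \<le> 2 ^ j
     \<and> \<bar>of_int q1 * y1 + of_int q2 * y2 + of_int p\<bar> \<le> 3 / 2 ^ k)"

text \<open>Among any \<open>L + 1\<close> consecutive positions one is good, for otherwise
  \<open>bad_run\<close> would make the point exceptional. After it the next \<open>K\<close>
  positions are skipped, so each good position uses up at most \<open>L + K\<close>.\<close>

lemma many_good_positions:
  fixes B :: nat
  assumes c: "0 < c" "c \<le> 1" and B: "12 \<le> c * real B" "8 * B\<^sup>2 \<le> 2 ^ R"
    and fail: "\<not> improvable_at c k y1 y2" and exc: "\<not> exceptional L k y1 y2"
    and j: "R \<le> j" "j + r * (L + K) \<le> k"
  shows "spaced (\<lambda>j y. \<not> (\<exists>q1 q2 p. bad_vec R k j y1 y q1 q2 p)) K k r j y2"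
  using j
proof (induction r arbitrary: j)
  case (Suc r)
  let ?bad = "\<lambda>i. \<exists>q1 q2 p. bad_vec R k i y1 y2 q1 q2 p"
  have "\<exists>i. j \<le> i \<and> i \<le> j + L \<and> \<not> ?bad i"
  proof (rule ccontr)
    assume "\<not> ?thesis"
    then obtain q1 q2 p where w: "bad_vec R k j y1 y2 q1 q2 p" "bad_vec R k (j + L) y1 y2 q1 q2 p"
      using bad_run[OF c B, of j L k y1 y2] fail Suc.prems by auto
    have "\<bar>q2\<bar> * 1 \<le> \<bar>q2\<bar> * 2 ^ R" by (intro mult_left_mono) auto
    moreover have "\<bar>q2\<bar> * 2 ^ R < 2 ^ j" using w(1) unfolding bad_vec_def by blast
    ultimately have "\<bar>q2\<bar> \<le> 2 ^ j" by simp
    moreover have "j + L \<le> k" using Suc.prems by simp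
    ultimately have "exceptional L k y1 y2"
      using w(2) unfolding exceptional_def bad_vec_def by blast
    with exc show False ..
  qed
  then obtain i where i: "j \<le> i" "i \<le> j + L" "\<not> ?bad i" by blast
  have "spaced (\<lambda>j y. \<not> (\<exists>q1 q2 p. bad_vec R k j y1 y q1 q2 p)) K k r (j + L + K) y2"
    by (rule Suc.IH) (use Suc.prems in \<open>auto simp: algebra_simps\<close>)
  then have "spaced (\<lambda>j y. \<not> (\<exists>q1 q2 p. bad_vec R k j y1 y q1 q2 p)) K k r (i + K) y2"
    by (rule spaced_antimono) (use i in auto)
  moreover have "i \<le> k" using i Suc.prems by auto
  ultimately show ?case using i by auto
qed simp

section \<open>Almost every pair\<close>

text \<open>Each integer \<open>p\<close> contributes an interval of length
  \<open>2 * \<delta> / n\<close> with \<open>n = \<bar>a\<bar>\<close>, and at most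
  \<open>2 * n + 2 * \<delta> + 1 \<le> 4 * n\<close> integers matter on a unit interval. The factor
  \<open>n\<close> cancels, so the bound is uniform in \<open>a\<close> and
  \<open>\<beta>\<close>.\<close>

lemma near_integer_cover:
  fixes a :: int and b \<beta> \<delta> :: real
  assumes a: "a \<noteq> 0" and \<delta>: "0 \<le> \<delta>" "\<delta> \<le> 1 / 2"
  shows "\<exists>A\<in>sets lborel. {y. b \<le> y \<and> y < b + 1 \<and> (\<exists>p::int. \<bar>\<beta> + of_int a * y + of_int p\<bar> \<le> \<delta>)} \<subseteq> A
           \<and> emeasure lborel A \<le> ennreal (8 * \<delta>)"
proof (rule cover_UN)
  define n where "n = \<bar>real_of_int a\<bar>"
  define t where "t = of_int a * b + \<beta>"
  define P where "P = {\<lceil>- t - n - \<delta>\<rceil>..\<lfloor>- t + n + \<delta>\<rfloor>}"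
  define X where "X = (\<lambda>p::int. {y. \<bar>\<beta> + of_int a * y + of_int p\<bar> \<le> \<delta>})"
  have n: "n \<ge> 1" using a unfolding n_def by linarith
  show "finite P" by (simp add: P_def)
  show e0: "0 \<le> 2 * \<delta> / n" using \<delta> n by simp
  show "\<exists>A\<in>sets lborel. X p \<subseteq> A \<and> emeasure lborel A \<le> ennreal (2 * \<delta> / n)" for p
  proof (intro bexI conjI)
    define z where "z = - (\<beta> + of_int p) / of_int a"
    show "X p \<subseteq> {z - \<delta> / n..z + \<delta> / n}"
    proof
      fix y assume "y \<in> X p"
      moreover have "of_int a * z = - (\<beta> + of_int p)" unfolding z_def using a by simp
      then have "of_int a * (y - z) = \<beta> + of_int a * y + of_int p"
        by (simp only: right_diff_distrib)
      ultimately have "\<bar>of_int a * (y - z)\<bar> \<le> \<delta>" by (simp add: X_def)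
      then have "n * \<bar>y - z\<bar> \<le> \<delta>" by (simp add: n_def abs_mult)
      then have "\<bar>y - z\<bar> \<le> \<delta> / n" using n by (simp add: field_simps)
      then show "y \<in> {z - \<delta> / n..z + \<delta> / n}" unfolding atLeastAtMost_iff by linarith
    qed
    have "0 \<le> \<delta> / n" using \<delta> n by simp
    then show "emeasure lborel {z - \<delta> / n..z + \<delta> / n} \<le> ennreal (2 * \<delta> / n)" by simp
  qed simp
  show "{y. b \<le> y \<and> y < b + 1 \<and> (\<exists>p::int. \<bar>\<beta> + of_int a * y + of_int p\<bar> \<le> \<delta>)} \<subseteq> (\<Union>p\<in>P. X p)"
  proof
    fix y assume "y \<in> {y. b \<le> y \<and> y < b + 1 \<and> (\<exists>p::int. \<bar>\<beta> + of_int a * y + of_int p\<bar> \<le> \<delta>)}"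
    then obtain p :: int where p: "b \<le> y" "y < b + 1" "\<bar>\<beta> + of_int a * y + of_int p\<bar> \<le> \<delta>" by blast
    have "\<bar>of_int a * (y - b)\<bar> \<le> n * 1"
      unfolding abs_mult n_def using p by (intro mult_mono) auto
    moreover have "\<beta> + of_int a * y + of_int p = of_int a * (y - b) + t + of_int p"
      by (simp add: t_def algebra_simps)
    ultimately have "\<bar>t + of_int p\<bar> \<le> n + \<delta>" using p(3) by linarith
    then have "- t - n - \<delta> \<le> of_int p" "of_int p \<le> - t + n + \<delta>" by linarith+
    then have "p \<in> P" unfolding P_def by (simp add: ceiling_le_iff le_floor_iff)
    then show "y \<in> (\<Union>p\<in>P. X p)" using p(3) by (auto simp: X_def)
  qed
  have "real (card P) \<le> 2 * n + 2 * \<delta> + 1"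
  proof -
    have "real_of_int \<lfloor>- t + n + \<delta>\<rfloor> \<le> - t + n + \<delta>" "- t - n - \<delta> \<le> real_of_int \<lceil>- t - n - \<delta>\<rceil>" by linarith+
    moreover have "real (card P) = max 0 (of_int (\<lfloor>- t + n + \<delta>\<rfloor> + 1 - \<lceil>- t - n - \<delta>\<rceil>))"
      by (simp add: P_def)
    ultimately show ?thesis using n \<delta> unfolding of_int_add of_int_diff of_int_1 by linarith
  qed
  also have "\<dots> \<le> 4 * n" using n \<delta> by linarith
  finally have "real (card P) * (2 * \<delta> / n) \<le> 4 * n * (2 * \<delta> / n)"
    using e0 by (intro mult_right_mono)
  then show "real (card P) * (2 * \<delta> / n) \<le> 8 * \<delta>" using n by simp
qed

lemma emeasure_le_fibres:
  fixes E :: "(real \<times> real) set"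
  assumes "E \<in> sets borel" "E \<subseteq> {a..<a + 1} \<times> UNIV" "0 \<le> e"
    and "\<And>x. \<exists>A\<in>sets lborel. {y. (x, y) \<in> E} \<subseteq> A \<and> emeasure lborel A \<le> ennreal e"
  shows "emeasure lborel E \<le> ennreal e"
proof -
  have E: "E \<in> sets (lborel \<Otimes>\<^sub>M lborel)" using assms(1) by (simp only: lborel_prod sets_lborel)
  have "emeasure lborel E = emeasure (lborel \<Otimes>\<^sub>M lborel) E" by (simp add: lborel_prod)
  also have "\<dots> = (\<integral>\<^sup>+x. emeasure lborel (Pair x -` E) \<partial>lborel)"
    by (rule lborel.emeasure_pair_measure_alt[OF E])
  also have "\<dots> \<le> (\<integral>\<^sup>+x. ennreal e * indicator {a..<a + 1} x \<partial>lborel)"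
  proof (rule nn_integral_mono)
    fix x :: real
    obtain A where A: "A \<in> sets lborel" "{y. (x, y) \<in> E} \<subseteq> A" "emeasure lborel A \<le> ennreal e"
      using assms(4) by blast
    have "emeasure lborel (Pair x -` E) \<le> ennreal e"
      using emeasure_mono[of "Pair x -` E" A lborel] A by (auto simp: vimage_def)
    moreover have "Pair x -` E = {}" if "x \<notin> {a..<a + 1}" using that assms(2) by auto
    ultimately show "emeasure lborel (Pair x -` E) \<le> ennreal e * indicator {a..<a + 1} x"
      by (cases "x \<in> {a..<a + 1}") auto
  qed
  also have "\<dots> = ennreal e" by (simp add: nn_integral_cmult_indicator)
  finally show ?thesis .
qed

lemma emeasure_le_fibres_snd:
  fixes E :: "(real \<times> real) set"
  assumes "E \<in> sets borel" "E \<subseteq> UNIV \<times> {b..<b + 1}" "0 \<le> e"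
    and "\<And>y. \<exists>A\<in>sets lborel. {x. (x, y) \<in> E} \<subseteq> A \<and> emeasure lborel A \<le> ennreal e"
  shows "emeasure lborel E \<le> ennreal e"
proof -
  have E: "E \<in> sets (lborel \<Otimes>\<^sub>M lborel)" using assms(1) by (simp only: lborel_prod sets_lborel)
  have "emeasure lborel E = emeasure (lborel \<Otimes>\<^sub>M lborel) E" by (simp add: lborel_prod)
  also have "\<dots> = (\<integral>\<^sup>+y. emeasure lborel ((\<lambda>x. (x, y)) -` E) \<partial>lborel)"
    by (rule lborel_pair.emeasure_pair_measure_alt2[OF E])
  also have "\<dots> \<le> (\<integral>\<^sup>+y. ennreal e * indicator {b..<b + 1} y \<partial>lborel)"
  proof (rule nn_integral_mono)
    fix y :: real
    obtain A where A: "A \<in> sets lborel" "{x. (x, y) \<in> E} \<subseteq> A" "emeasure lborel A \<le> ennreal e"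
      using assms(4) by blast
    have "emeasure lborel ((\<lambda>x. (x, y)) -` E) \<le> ennreal e"
      using emeasure_mono[of "(\<lambda>x. (x, y)) -` E" A lborel] A by (auto simp: vimage_def)
    moreover have "(\<lambda>x. (x, y)) -` E = {}" if "y \<notin> {b..<b + 1}" using that assms(2) by auto
    ultimately show "emeasure lborel ((\<lambda>x. (x, y)) -` E) \<le> ennreal e * indicator {b..<b + 1} y"
      by (cases "y \<in> {b..<b + 1}") auto
  qed
  also have "\<dots> = ennreal e" by (simp add: nn_integral_cmult_indicator)
  finally show ?thesis .
qed

text \<open>Integrate over slices along a coordinate with nonzero coefficient: the second one if
  \<open>q2 \<noteq> 0\<close>, otherwise the first.\<close>

lemma near_integer_form_emeasure:
  fixes q1 q2 :: int and a b \<delta> :: real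
  assumes q: "q1 \<noteq> 0 \<or> q2 \<noteq> 0" and \<delta>: "0 \<le> \<delta>" "\<delta> \<le> 1 / 2"
  defines "E \<equiv> {y \<in> {a..<a + 1} \<times> {b..<b + 1}.
      \<exists>p::int. \<bar>of_int q1 * fst y + of_int q2 * snd y + of_int p\<bar> \<le> \<delta>}"
  shows "E \<in> sets borel" "emeasure lborel E \<le> ennreal (8 * \<delta>)"
proof -
  have "{a..<a + 1} \<times> {b..<b + 1} \<in> sets (borel \<Otimes>\<^sub>M borel :: (real \<times> real) measure)"
    by (rule pair_measureI) simp_all
  then have "{a..<a + 1} \<times> {b..<b + 1} \<in> sets (borel :: (real \<times> real) measure)"
    by (simp only: borel_prod)
  moreover have "{y \<in> space (borel \<Otimes>\<^sub>M borel). \<exists>p::int. \<bar>of_int q1 * fst y + of_int q2 * snd y + of_int p\<bar> \<le> \<delta>}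
      \<in> sets (borel \<Otimes>\<^sub>M borel :: (real \<times> real) measure)"
    by measurable
  then have "{y \<in> space borel. \<exists>p::int. \<bar>of_int q1 * fst y + of_int q2 * snd y + of_int p\<bar> \<le> \<delta>}
      \<in> sets (borel :: (real \<times> real) measure)"
    by (simp only: borel_prod)
  ultimately have "({a..<a + 1} \<times> {b..<b + 1}) \<inter>
      {y \<in> space borel. \<exists>p::int. \<bar>of_int q1 * fst y + of_int q2 * snd y + of_int p\<bar> \<le> \<delta>}
      \<in> sets (borel :: (real \<times> real) measure)" by (rule sets.Int)
  then show E: "E \<in> sets borel" unfolding E_def Int_def by (simp only: mem_Collect_eq space_borel UNIV_I simp_thms)
  show "emeasure lborel E \<le> ennreal (8 * \<delta>)"
  proof (cases "q2 = 0")
    case False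
    show ?thesis
    proof (rule emeasure_le_fibres[OF E, of a])
      show "E \<subseteq> {a..<a + 1} \<times> UNIV" by (auto simp: E_def)
      show "\<exists>A\<in>sets lborel. {y. (x, y) \<in> E} \<subseteq> A \<and> emeasure lborel A \<le> ennreal (8 * \<delta>)" for x
      proof -
        obtain A where A: "A \<in> sets lborel" "emeasure lborel A \<le> ennreal (8 * \<delta>)"
          "{y. b \<le> y \<and> y < b + 1 \<and> (\<exists>p::int. \<bar>of_int q1 * x + of_int q2 * y + of_int p\<bar> \<le> \<delta>)} \<subseteq> A"
          using near_integer_cover[OF False \<delta>, of b "of_int q1 * x"] by meson
        moreover have "{y. (x, y) \<in> E} \<subseteq> {y. b \<le> y \<and> y < b + 1 \<and>
            (\<exists>p::int. \<bar>of_int q1 * x + of_int q2 * y + of_int p\<bar> \<le> \<delta>)}"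
          by (simp add: E_def subset_eq)
        ultimately show ?thesis by (meson order.trans)
      qed
    qed (use \<delta> in simp)
  next
    case True
    then have q1: "q1 \<noteq> 0" using q by simp
    show ?thesis
    proof (rule emeasure_le_fibres_snd[OF E, of b])
      show "E \<subseteq> UNIV \<times> {b..<b + 1}" by (auto simp: E_def)
      show "\<exists>A\<in>sets lborel. {x. (x, y) \<in> E} \<subseteq> A \<and> emeasure lborel A \<le> ennreal (8 * \<delta>)" for y
      proof -
        obtain A where A: "A \<in> sets lborel" "emeasure lborel A \<le> ennreal (8 * \<delta>)"
          "{x. a \<le> x \<and> x < a + 1 \<and> (\<exists>p::int. \<bar>0 + of_int q1 * x + of_int p\<bar> \<le> \<delta>)} \<subseteq> A"
          using near_integer_cover[OF q1 \<delta>, of a 0] by meson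
        moreover have "{x. (x, y) \<in> E} \<subseteq> {x. a \<le> x \<and> x < a + 1 \<and>
            (\<exists>p::int. \<bar>0 + of_int q1 * x + of_int p\<bar> \<le> \<delta>)}"
          using True by (simp add: E_def subset_eq)
        ultimately show ?thesis by (meson order.trans)
      qed
    qed (use \<delta> in simp)
  qed
qed

text \<open>There are at most \<open>k + 1\<close> values of \<open>j\<close>, for each at most
  \<open>9 * 2 ^ (k - L)\<close> vectors, and each vector costs \<open>8 * 3 / 2 ^ k\<close>; the
  product of the constants is 216. The bound \<open>3 \<le> k\<close> ensures
  \<open>3 / 2 ^ k \<le> 1 / 2\<close>.\<close>

lemma exceptional_emeasure:
  fixes a b :: real
  assumes k: "3 \<le> k" "L \<le> k"
  defines "E \<equiv> {y \<in> {a..<a + 1} \<times> {b..<b + 1}. exceptional L k (fst y) (snd y)}"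
  shows "\<exists>A\<in>sets lborel. E \<subseteq> A \<and> emeasure lborel A \<le> ennreal (216 * (real k + 1) / 2 ^ L)"
proof (rule cover_UN)
  define \<delta> where "\<delta> = 3 / (2::real) ^ k"
  have "(2::real) ^ 3 \<le> 2 ^ k" using k by (intro power_increasing) auto
  then have \<delta>: "0 \<le> \<delta>" "\<delta> \<le> 1 / 2" by (auto simp: \<delta>_def field_simps)
  define X where "X = (\<lambda>q. {y \<in> {a..<a + 1} \<times> {b..<b + 1}.
      \<exists>p::int. \<bar>of_int (fst q) * fst y + of_int (snd q) * snd y + of_int p\<bar> \<le> \<delta>})"
  define F :: "nat \<Rightarrow> (int \<times> int) set" where
    "F = (\<lambda>j. {- (2 ^ (k - (j + L)))..2 ^ (k - (j + L))} \<times> {- (2 ^ j)..2 ^ j} - {(0, 0)})"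
  show "finite {..k - L}" by simp
  show "0 \<le> 216 / (2::real) ^ L" by simp
  show "real (card {..k - L}) * (216 / 2 ^ L) \<le> 216 * (real k + 1) / 2 ^ L"
    using k by (simp add: divide_right_mono of_nat_diff)
  show "\<exists>A\<in>sets lborel. (\<Union>q\<in>F j. X q) \<subseteq> A \<and> emeasure lborel A \<le> ennreal (216 / 2 ^ L)"
    if "j \<in> {..k - L}" for j
  proof (rule cover_UN)
    have j: "j + L \<le> k" using that k by auto
    show "finite (F j)" by (simp add: F_def)
    show "0 \<le> 8 * \<delta>" using \<delta> by simp
    show "\<exists>A\<in>sets lborel. X q \<subseteq> A \<and> emeasure lborel A \<le> ennreal (8 * \<delta>)" if "q \<in> F j" for q
    proof -
      have "fst q \<noteq> 0 \<or> snd q \<noteq> 0" using that by (cases q) (auto simp: F_def)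
      from near_integer_form_emeasure[OF this \<delta>, of a b] show ?thesis
        unfolding X_def by (intro bexI[of _ "X q"]) (auto simp: X_def)
    qed
    show "(\<Union>q\<in>F j. X q) \<subseteq> (\<Union>q\<in>F j. X q)" ..
    have "real (card (F j)) \<le> real (card ({- (2 ^ (k - (j + L)))..2 ^ (k - (j + L)) :: int} \<times> {- (2 ^ j)..2 ^ j :: int}))"
      unfolding F_def by (intro of_nat_mono card_mono) auto
    also have "\<dots> = (2 * 2 ^ (k - (j + L)) + 1) * (2 * 2 ^ j + 1)"
      by (simp add: card_cartesian_product of_nat_nat)
    also have "\<dots> \<le> (3 * 2 ^ (k - (j + L))) * (3 * 2 ^ j)"
      by (intro mult_mono) auto
    also have "\<dots> = 9 * 2 ^ (k - L)" using j by (simp flip: power_add)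
    also have "\<dots> = 9 * (2 ^ k / 2 ^ L)" using k by (simp add: power_diff)
    finally have "real (card (F j)) * (8 * \<delta>) \<le> 9 * (2 ^ k / 2 ^ L) * (8 * \<delta>)"
      using \<delta> by (intro mult_right_mono) auto
    also have "\<dots> = 216 / 2 ^ L" by (simp add: \<delta>_def)
    finally show "real (card (F j)) * (8 * \<delta>) \<le> 216 / 2 ^ L" .
  qed
  show "E \<subseteq> (\<Union>j\<in>{..k - L}. \<Union>q\<in>F j. X q)"
  proof
    fix y assume y: "y \<in> E"
    then obtain j q1 q2 p where w: "j + L \<le> k" "q1 \<noteq> 0 \<or> q2 \<noteq> 0"
      "\<bar>q1\<bar> \<le> 2 ^ (k - (j + L))" "\<bar>q2\<bar> \<le> 2 ^ j"
      "\<bar>of_int q1 * fst y + of_int q2 * snd y + of_int p\<bar> \<le> \<delta>"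
      unfolding E_def exceptional_def \<delta>_def by blast
    have "(q1, q2) \<in> F j" using w by (auto simp: F_def abs_le_iff)
    moreover have "y \<in> X (q1, q2)" using y w unfolding X_def E_def by auto
    moreover have "j \<in> {..k - L}" using w by simp
    ultimately show "y \<in> (\<Union>j\<in>{..k - L}. \<Union>q\<in>F j. X q)" by blast
  qed
qed

section \<open>Measure of the failures and the Borel-Cantelli argument\<close>

text \<open>Off a cover of the exceptional points, each failing point has \<open>r\<close> spaced
  good positions, for which \<open>R + r * (L + K) \<le> k\<close> leaves room. There
  \<open>fibre_cover\<close> bounds every fibre; the cover itself accounts for the second
  summand.\<close>

lemma failure_emeasure:
  fixes a b :: real and B :: nat
  assumes c: "0 < c" "c \<le> 1" and B: "12 \<le> c * real B" "8 * B\<^sup>2 \<le> 2 ^ R"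
    and K: "4 * 2 ^ R \<le> c * 2 ^ K" "K > 0" and k: "3 \<le> k" "R + r * (L + K) \<le> k" "L \<le> k"
  defines "E \<equiv> {y \<in> {a..<a + 1} \<times> {b..<b + 1}. \<not> improvable_at c k (fst y) (snd y)}"
  shows "E \<in> sets lborel"
    "emeasure lborel E \<le> ennreal ((1 - 1 / 2 ^ K) ^ r + 216 * (real k + 1) / 2 ^ L)"
proof -
  have "{a..<a + 1} \<times> {b..<b + 1} \<in> sets (borel \<Otimes>\<^sub>M borel :: (real \<times> real) measure)"
    by (rule pair_measureI) simp_all
  then have "{a..<a + 1} \<times> {b..<b + 1} \<in> sets (borel :: (real \<times> real) measure)"
    by (simp only: borel_prod)
  moreover have "{y \<in> space (borel \<Otimes>\<^sub>M borel). \<not> improvable_at c k (fst y) (snd y)}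
      \<in> sets (borel \<Otimes>\<^sub>M borel :: (real \<times> real) measure)"
    unfolding improvable_at_def by measurable
  then have "{y \<in> space borel. \<not> improvable_at c k (fst y) (snd y)} \<in> sets (borel :: (real \<times> real) measure)"
    by (simp only: borel_prod)
  ultimately have "({a..<a + 1} \<times> {b..<b + 1}) \<inter> {y \<in> space borel. \<not> improvable_at c k (fst y) (snd y)}
      \<in> sets (borel :: (real \<times> real) measure)" by (rule sets.Int)
  then have E: "E \<in> sets borel" unfolding E_def Int_def by (simp only: mem_Collect_eq space_borel UNIV_I simp_thms)
  then show "E \<in> sets lborel" by simp
  obtain X where X: "X \<in> sets lborel" "emeasure lborel X \<le> ennreal (216 * (real k + 1) / 2 ^ L)"
    "{y \<in> {a..<a + 1} \<times> {b..<b + 1}. exceptional L k (fst y) (snd y)} \<subseteq> X"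
    using exceptional_emeasure[OF k(1,3), of a b] by meson
  \<comment> \<open>The measurable cover \<open>X\<close> is removed rather than the exceptional
    set, so that the remaining set can be integrated over its fibres.\<close>
  have EX: "emeasure lborel (E - X) \<le> ennreal ((1 - 1 / 2 ^ K) ^ r)"
  proof (rule emeasure_le_fibres)
    show "E - X \<in> sets borel" using E X by auto
    show "E - X \<subseteq> {a..<a + 1} \<times> UNIV" by (auto simp: E_def)
    show "0 \<le> (1 - 1 / (2::real) ^ K) ^ r" by simp
    fix x :: real
    let ?g = "\<lambda>j y. \<not> (\<exists>q1 q2 p. bad_vec R k j x y q1 q2 p)"
    have "{y. (x, y) \<in> E - X} \<subseteq> {y. b \<le> y \<and> y < b + 1 \<and> \<not> improvable_at c k x y \<and> spaced ?g K k r R y}"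
    proof
      fix y assume y: "y \<in> {y. (x, y) \<in> E - X}"
      then have "\<not> improvable_at c k x y" "b \<le> y" "y < b + 1" "\<not> exceptional L k x y"
        using subsetD[OF X(3), of "(x, y)"] by (auto simp: E_def)
      then show "y \<in> {y. b \<le> y \<and> y < b + 1 \<and> \<not> improvable_at c k x y \<and> spaced ?g K k r R y}"
        using many_good_positions[OF c B, of k x y L R r K] k by simp
    qed
    moreover have "R \<le> k" "2 \<le> k" using k by auto
    ultimately show "\<exists>A\<in>sets lborel. {y. (x, y) \<in> E - X} \<subseteq> A \<and> emeasure lborel A \<le> ennreal ((1 - 1 / 2 ^ K) ^ r)"
      using fibre_cover[OF K, of k b x r] by (meson order.trans)
  qed
  have "emeasure lborel E \<le> emeasure lborel ((E - X) \<union> X)"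
    using E X by (intro emeasure_mono) auto
  also have "\<dots> \<le> emeasure lborel (E - X) + emeasure lborel X"
    using E X by (intro emeasure_subadditive) auto
  also have "\<dots> \<le> ennreal ((1 - 1 / 2 ^ K) ^ r) + ennreal (216 * (real k + 1) / 2 ^ L)"
    using EX X by (intro add_mono)
  also have "\<dots> = ennreal ((1 - 1 / 2 ^ K) ^ r + 216 * (real k + 1) / 2 ^ L)"
    by (simp add: ennreal_plus)
  finally show "emeasure lborel E \<le> ennreal ((1 - 1 / 2 ^ K) ^ r + 216 * (real k + 1) / 2 ^ L)" .
qed

text \<open>Both \<open>L\<close> and the number of good positions grow like \<open>sqrt k\<close>,
  so the two terms decay like exponentials of \<open>- sqrt k\<close> and eventually drop below
  \<open>1 / k\<^sup>2\<close>. The rounding in the floor and in \<open>div\<close> costs at most 1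
  in each exponent.\<close>

lemma summable_failure_bound:
  assumes K: "K > (0::nat)"
  shows "summable (\<lambda>k. (1 - 1 / 2 ^ K) ^ ((k - R) div (nat \<lfloor>sqrt (real k)\<rfloor> + K))
           + 216 * (real k + 1) / 2 ^ nat \<lfloor>sqrt (real k)\<rfloor> :: real)"
proof (rule summable_comparison_test_ev)
  define l where "l = - ln (1 - 1 / (2::real) ^ K)"
  have "(1::real) < 2 ^ K" using K by simp
  then have th: "0 < 1 - 1 / (2::real) ^ K" "1 - 1 / (2::real) ^ K < 1" by auto
  then have l: "l > 0" unfolding l_def by simp
  have "\<forall>\<^sub>F k in sequentially. exp (- l * ((real k - real R) / (sqrt (real k) + real K) - 1)) \<le> 1 / real k ^ 2"
    using l by real_asymp
  moreover have "\<forall>\<^sub>F k in sequentially. 216 * (real k + 1) / 2 powr (sqrt (real k) - 1) \<le> 1 / real k ^ 2"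
    by real_asymp
  ultimately show "\<forall>\<^sub>F k in sequentially. norm ((1 - 1 / 2 ^ K) ^ ((k - R) div (nat \<lfloor>sqrt (real k)\<rfloor> + K))
           + 216 * (real k + 1) / 2 ^ nat \<lfloor>sqrt (real k)\<rfloor> :: real) \<le> 2 * (1 / real k ^ 2)"
    using eventually_ge_at_top[of R]
  proof eventually_elim
    case (elim k)
    define L where "L = nat \<lfloor>sqrt (real k)\<rfloor>"
    define r where "r = (k - R) div (L + K)"
    have L: "real L \<le> sqrt (real k)" "sqrt (real k) - 1 \<le> real L"
      unfolding L_def by (simp add: of_nat_floor) linarith
    have "(real k - real R) / (sqrt (real k) + real K) \<le> (real k - real R) / (real L + real K)"
      using L K elim(3) by (intro divide_left_mono) auto
    also have "\<dots> = real (k - R) / real (L + K)" using elim(3) by (simp add: of_nat_diff)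
    also have "\<dots> \<le> real r + 1"
    proof -
      have "k - R \<le> (L + K) + r * (L + K)"
        unfolding r_def using dividend_less_div_times[of "L + K" "k - R"] K by simp
      then have "real (k - R) \<le> real ((r + 1) * (L + K))" by (simp only: of_nat_le_iff) simp
      then show ?thesis using K by (simp add: pos_divide_le_eq distrib_right)
    qed
    finally have r: "(real k - real R) / (sqrt (real k) + real K) - 1 \<le> real r" by simp
    have "(1 - 1 / (2::real) ^ K) ^ r = exp (- l * real r)"
    proof -
      have "exp (- l * real r) = exp (real r * ln (1 - 1 / (2::real) ^ K))"
        by (simp add: l_def mult.commute)
      also have "\<dots> = exp (ln (1 - 1 / (2::real) ^ K)) ^ r" by (rule exp_of_nat_mult)
      also have "exp (ln (1 - 1 / (2::real) ^ K)) = 1 - 1 / 2 ^ K" using th by (simp only: exp_ln)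
      finally show ?thesis by simp
    qed
    also have "\<dots> \<le> exp (- l * ((real k - real R) / (sqrt (real k) + real K) - 1))"
      using r l by simp
    also have "\<dots> \<le> 1 / real k ^ 2" using elim(1) .
    finally have 1: "(1 - 1 / (2::real) ^ K) ^ r \<le> 1 / real k ^ 2" .
    have "2 powr (sqrt (real k) - 1) \<le> 2 powr real L" using L by simp
    also have "\<dots> = 2 ^ L" by (simp add: powr_realpow)
    finally have "216 * (real k + 1) / 2 ^ L \<le> 216 * (real k + 1) / 2 powr (sqrt (real k) - 1)"
      by (intro divide_left_mono) auto
    then have 2: "216 * (real k + 1) / 2 ^ L \<le> 1 / real k ^ 2" using elim(2) by linarith
    have "0 \<le> (1 - 1 / (2::real) ^ K) ^ r" "0 \<le> 216 * (real k + 1) / 2 ^ L" using th by auto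
    then show ?case using 1 2 unfolding L_def[symmetric] r_def[symmetric] by simp
  qed
  show "summable (\<lambda>k. 2 * (1 / real k ^ 2))"
    using inverse_power_summable[of 2, where ?'a = real] by (intro summable_mult) (simp add: field_simps)
qed

lemma improvable_at_mono: "improvable_at c k y1 y2 \<Longrightarrow> c \<le> c' \<Longrightarrow> improvable_at c' k y1 y2"
  unfolding improvable_at_def by (smt (verit) divide_right_mono zero_le_power)

lemma AE_improvable_at_square:
  fixes a b :: real
  assumes c: "0 < c" "c \<le> 1"
  shows "AE y in (lborel :: (real \<times> real) measure). y \<in> {a..<a + 1} \<times> {b..<b + 1} \<longrightarrow>
           (\<forall>\<^sub>F k in sequentially. improvable_at c k (fst y) (snd y))"
proof -
  \<comment> \<open>The constants are chosen in the order \<open>B\<close>, \<open>R\<close>,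
    \<open>K\<close>, each in terms of \<open>c\<close> and its predecessors and independently of
    \<open>k\<close>; only \<open>L\<close> and \<open>r\<close> vary with \<open>k\<close>.\<close>
  obtain B :: nat where "12 / c \<le> real B" using real_arch_simple by blast
  then have B: "12 \<le> c * real B" using c by (simp add: field_simps)
  define R where "R = 8 * B\<^sup>2"
  have R: "8 * B\<^sup>2 \<le> 2 ^ R" unfolding R_def using less_exp[of "8 * B\<^sup>2"] by simp
  obtain K :: nat where "4 * 2 ^ R / c < 2 ^ K" using real_arch_pow[of 2 "4 * 2 ^ R / c"] by auto
  then have K: "4 * 2 ^ R \<le> c * 2 ^ K" using c by (simp add: field_simps)
  have K0: "K > 0"
  proof (rule ccontr)
    assume "\<not> K > 0"
    then have "4 * 2 ^ R \<le> (1::real)" using K c by simp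
    moreover have "(1::real) \<le> 2 ^ R" by simp
    ultimately show False by linarith
  qed
  define L r where "L = (\<lambda>k. nat \<lfloor>sqrt (real k)\<rfloor>)" and "r = (\<lambda>k. (k - R) div (L k + K))"
  define E where "E = (\<lambda>k. {y \<in> {a..<a + 1} \<times> {b..<b + 1}. \<not> improvable_at c k (fst y) (snd y)})"
  \<comment> \<open>From here on \<open>3 \<le> k\<close> and \<open>R \<le> k\<close>, so the
    measure bound applies. Borel-Cantelli is used for the sequence shifted by
    \<open>k0\<close>.\<close>
  define k0 where "k0 = R + 3"
  have Ek: "E k \<in> sets lborel"
    "emeasure lborel (E k) \<le> ennreal ((1 - 1 / 2 ^ K) ^ r k + 216 * (real k + 1) / 2 ^ L k)"
    if "k \<ge> k0" for k
  proof -
    have "r k * (L k + K) \<le> k - R" unfolding r_def by (rule div_times_less_eq_dividend)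
    then have 1: "R + r k * (L k + K) \<le> k" using that by (simp add: k0_def)
    have "sqrt (real k) \<le> sqrt (real k * real k)"
      using that by (intro real_sqrt_le_mono) (simp add: k0_def)
    then have "sqrt (real k) \<le> real k" by simp
    then have 2: "L k \<le> k" unfolding L_def by linarith
    have 3: "3 \<le> k" using that by (simp add: k0_def)
    from failure_emeasure[OF c B R K K0 3 1 2, of a b] show "E k \<in> sets lborel"
      "emeasure lborel (E k) \<le> ennreal ((1 - 1 / 2 ^ K) ^ r k + 216 * (real k + 1) / 2 ^ L k)"
      unfolding E_def by auto
  qed
  have "AE y in lborel. \<forall>\<^sub>F n in sequentially. y \<in> space lborel - E (n + k0)"
  proof (rule borel_cantelli_AE1)
    show "E (n + k0) \<in> sets lborel" for n using Ek by simp
    show "emeasure lborel (E (n + k0)) < \<infinity>" for n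
      using Ek(2)[of "n + k0"] by (simp add: order_le_less_trans)
    show "summable (\<lambda>n. measure lborel (E (n + k0)))"
    proof (rule summable_comparison_test_ev)
      show "summable (\<lambda>n. (1 - 1 / 2 ^ K) ^ r (n + k0) + 216 * (real (n + k0) + 1) / 2 ^ L (n + k0) :: real)"
        using summable_ignore_initial_segment[OF summable_failure_bound[OF K0, of R], of k0]
        unfolding L_def r_def by simp
      show "\<forall>\<^sub>F n in sequentially. norm (measure lborel (E (n + k0)))
          \<le> (1 - 1 / 2 ^ K) ^ r (n + k0) + 216 * (real (n + k0) + 1) / 2 ^ L (n + k0)"
      proof (intro always_eventually allI)
        fix n
        have "0 \<le> (1 - 1 / (2::real) ^ K) ^ r (n + k0) + 216 * (real (n + k0) + 1) / 2 ^ L (n + k0)"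
          by (intro add_nonneg_nonneg) auto
        then show "norm (measure lborel (E (n + k0)))
          \<le> (1 - 1 / 2 ^ K) ^ r (n + k0) + 216 * (real (n + k0) + 1) / 2 ^ L (n + k0)"
          using Ek(2)[of "n + k0"] unfolding measure_def by (simp add: enn2real_leI)
      qed
    qed
  qed
  then show ?thesis
  proof (rule AE_mp, intro AE_I2 impI)
    fix y :: "real \<times> real"
    assume ev: "\<forall>\<^sub>F n in sequentially. y \<in> space lborel - E (n + k0)"
      and y: "y \<in> {a..<a + 1} \<times> {b..<b + 1}"
    have "\<forall>\<^sub>F n in sequentially. improvable_at c (n + k0) (fst y) (snd y)"
      using ev by eventually_elim (use y in \<open>simp add: E_def\<close>)
    then show "\<forall>\<^sub>F k in sequentially. improvable_at c k (fst y) (snd y)"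
      by (rule eventually_sequentially_seg[THEN iffD1])
  qed
qed

text \<open>Countably many null sets suffice for all \<open>c\<close> at once: integer translates of
  the unit square and \<open>c = 1 / (N + 1)\<close>, followed by monotonicity in
  \<open>c\<close>.\<close>

lemma AE_improvable_at:
  "AE y in (lborel :: (real \<times> real) measure).
     \<forall>c>0. \<forall>\<^sub>F k in sequentially. improvable_at c k (fst y) (snd y)"
proof -
  have "AE y in (lborel :: (real \<times> real) measure). \<forall>(m::int) (n::int) (N::nat).
      y \<in> {of_int m..<of_int m + 1} \<times> {of_int n..<of_int n + 1} \<longrightarrow>
      (\<forall>\<^sub>F k in sequentially. improvable_at (1 / real (Suc N)) k (fst y) (snd y))"
    unfolding AE_all_countable by (intro allI AE_improvable_at_square) auto
  then show ?thesis
  proof (rule AE_mp, intro AE_I2 impI allI)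
    fix y :: "real \<times> real" and c :: real
    assume y: "\<forall>(m::int) (n::int) (N::nat).
      y \<in> {of_int m..<of_int m + 1} \<times> {of_int n..<of_int n + 1} \<longrightarrow>
      (\<forall>\<^sub>F k in sequentially. improvable_at (1 / real (Suc N)) k (fst y) (snd y))" and c: "c > 0"
    obtain N where N: "1 / real (Suc N) < c" using nat_approx_posE[OF c] by auto
    have "y \<in> {of_int \<lfloor>fst y\<rfloor>..<of_int \<lfloor>fst y\<rfloor> + 1} \<times> {of_int \<lfloor>snd y\<rfloor>..<of_int \<lfloor>snd y\<rfloor> + 1}"
      by (cases y) auto
    with y have "\<forall>\<^sub>F k in sequentially. improvable_at (1 / real (Suc N)) k (fst y) (snd y)" by blast
    then show "\<forall>\<^sub>F k in sequentially. improvable_at c k (fst y) (snd y)"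
      by eventually_elim (use N improvable_at_mono in \<open>auto intro: less_imp_le\<close>)
  qed
qed

section \<open>Transference and matrices\<close>

text \<open>Choose \<open>k\<close> with \<open>2 ^ k < T \<le> 2 ^ (k + 1)\<close>. The left
  inequality makes the height bound strict, the right one turns \<open>(c / 2) / 2 ^ k\<close> into
  at most \<open>c / T\<close>.\<close>

lemma linear_form_uniform:
  fixes y1 y2 c :: real
  assumes ev: "\<forall>\<^sub>F k in sequentially. improvable_at (c / 2) k y1 y2" and c: "c > 0"
  shows "\<exists>T0>1. \<forall>T\<ge>T0. \<exists>q1 q2 p :: int. (q1 \<noteq> 0 \<or> q2 \<noteq> 0) \<and>
    of_int (max 1 \<bar>q1\<bar> * max 1 \<bar>q2\<bar>) < T \<and> \<bar>of_int q1 * y1 + of_int q2 * y2 + of_int p\<bar> < c / T"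
proof -
  obtain k0 where k0: "\<And>k. k \<ge> k0 \<Longrightarrow> improvable_at (c / 2) k y1 y2"
    using ev unfolding eventually_sequentially by blast
  show ?thesis
  \<comment> \<open>The extra 1 forces the least \<open>m\<close> with \<open>T \<le> 2 ^ m\<close>
    to exceed \<open>k0\<close>, so that its predecessor \<open>k\<close> still satisfies
    \<open>k0 \<le> k\<close>.\<close>
  proof (rule exI[of _ "2 ^ k0 + 1"], intro conjI allI impI)
    show "1 < (2::real) ^ k0 + 1" by simp
    fix T :: real assume T: "2 ^ k0 + 1 \<le> T"
    obtain n where n0: "T < 2 ^ n" using real_arch_pow[of 2 T] by auto
    define m where "m = (LEAST n. T \<le> 2 ^ n)"
    have m: "T \<le> 2 ^ m" unfolding m_def by (rule LeastI[of _ n]) (use n0 in simp)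
    have "(2::real) ^ k0 < 2 ^ m" using m T by linarith
    then have "k0 < m" by simp
    then obtain k where k: "m = Suc k" "k0 \<le> k" by (cases m) auto
    have "\<not> T \<le> 2 ^ k" using not_less_Least[of k "\<lambda>n. T \<le> 2 ^ n"] k unfolding m_def by simp
    then have kT: "2 ^ k < T" by simp
    obtain q1 q2 p :: int where q: "q1 \<noteq> 0 \<or> q2 \<noteq> 0" "max 1 \<bar>q1\<bar> * max 1 \<bar>q2\<bar> \<le> 2 ^ k"
      "\<bar>of_int q1 * y1 + of_int q2 * y2 + of_int p\<bar> < c / 2 / 2 ^ k"
      using k0[OF k(2)] unfolding improvable_at_def by blast
    have "real_of_int (max 1 \<bar>q1\<bar> * max 1 \<bar>q2\<bar>) \<le> real_of_int (2 ^ k)"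
      using q(2) by (simp only: of_int_le_iff)
    then have 1: "real_of_int (max 1 \<bar>q1\<bar> * max 1 \<bar>q2\<bar>) < T" using kT by simp
    have "T > 0" using kT by (rule less_trans[rotated]) simp
    then have "c / 2 / 2 ^ k \<le> c / T"
      using m c k by (simp add: field_simps)
    then have 2: "\<bar>of_int q1 * y1 + of_int q2 * y2 + of_int p\<bar> < c / T" using q(3) by linarith
    show "\<exists>q1 q2 p :: int. (q1 \<noteq> 0 \<or> q2 \<noteq> 0) \<and>
      of_int (max 1 \<bar>q1\<bar> * max 1 \<bar>q2\<bar>) < T \<and> \<bar>of_int q1 * y1 + of_int q2 * y2 + of_int p\<bar> < c / T"
      using q(1) 1 2 by blast
  qed
qed

text \<open>By pigeonhole some \<open>(r, s1)\<close> lies in the lattice \<open>q1 s1 + p r = 0 (mod q2)\<close> and has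
  \<open>r y1\<close> close to \<open>s1\<close>; the remaining coordinate \<open>s2\<close> of a vector orthogonal to \<open>(q1, q2, p)\<close> is then
  determined, and \<open>q2 (r y2 - s2) = r L - q1 (r y1 - s1)\<close> for \<open>L = q1 y1 + q2 y2 + p\<close>.\<close>

lemma transference_nonzero:
  fixes y1 y2 \<eta> T :: real and q1 q2 p :: int
  assumes q2: "q2 \<noteq> 0" and \<eta>: "0 \<le> \<eta>" and T: "T > 0"
    and q: "of_int (\<bar>q1\<bar> * \<bar>q2\<bar>) \<le> \<eta> * T" "of_int \<bar>q2\<bar> \<le> T / 2"
    and L: "\<bar>of_int q1 * y1 + of_int q2 * y2 + of_int p\<bar> \<le> \<eta> / T"
  shows "\<exists>r s1 s2 :: int. r \<noteq> 0 \<and> of_int \<bar>r\<bar> < T \<and>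
    \<bar>of_int r * y1 - of_int s1\<bar> * \<bar>of_int r * y2 - of_int s2\<bar> \<le> 5 * \<eta> / T"
proof -
  define N where "N = nat \<bar>q2\<bar>"
  have N: "N > 0" "int N = \<bar>q2\<bar>" "real N = \<bar>real_of_int q2\<bar>" using q2 by (auto simp: N_def)
  \<comment> \<open>The largest integer strictly below \<open>T / N\<close>: it keeps
    \<open>N * A < T\<close>, and since \<open>T / N \<ge> 2\<close> it loses at most a factor 2, so
    \<open>N * A \<ge> T / 2\<close>.\<close>
  define A where "A = nat (\<lceil>T / real N\<rceil> - 1)"
  have NT: "2 \<le> T / real N" using q(2) N T by (simp add: field_simps)
  then have ge: "2 \<le> \<lceil>T / real N\<rceil>" by linarith
  then have Ar: "real A = of_int \<lceil>T / real N\<rceil> - 1" unfolding A_def by simp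
  have A0: "A > 0" using ge unfolding A_def by linarith
  have Alt: "real A < T / real N" unfolding Ar by linarith
  have "t / 2 \<le> of_int \<lceil>t\<rceil> - 1" if "2 \<le> t" for t :: real using that by linarith
  then have Age: "T / real N / 2 \<le> real A" unfolding Ar using NT by blast
  have ANlt: "real A * real N < T" using Alt N by (simp add: field_simps)
  have ANge: "T / 2 \<le> real A * real N" using Age N by (simp add: field_simps)
  \<comment> \<open>The pigeonholes are \<open>N\<close> residue classes times \<open>A\<close>
    cells of width \<open>1 / A\<close> for the fractional part of \<open>r * y1\<close>, against
    \<open>N * A + 1\<close> values of \<open>r\<close>.\<close>
  define w where "w = (\<lambda>r::nat. (nat ((q1 * \<lfloor>real r * y1\<rfloor> + p * int r) mod int N), nat \<lfloor>real A * frac (real r * y1)\<rfloor>))"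
  have "w ` {0..N * A} \<subseteq> {..<N} \<times> {..<A}"
  proof (rule image_subsetI)
    fix r assume "r \<in> {0..N * A}"
    have 1: "0 \<le> (q1 * \<lfloor>real r * y1\<rfloor> + p * int r) mod int N" "(q1 * \<lfloor>real r * y1\<rfloor> + p * int r) mod int N < int N"
      using N by simp_all
    have "0 \<le> real A * frac (real r * y1)" "real A * frac (real r * y1) < real A"
      using A0 by (simp_all add: frac_lt_1)
    then have 2: "0 \<le> \<lfloor>real A * frac (real r * y1)\<rfloor>" "\<lfloor>real A * frac (real r * y1)\<rfloor> < int A"
      by (simp_all only: zero_le_floor floor_less_iff of_int_of_nat_eq)
    show "w r \<in> {..<N} \<times> {..<A}"
      unfolding w_def using 1 2 by (simp only: mem_Sigma_iff lessThan_iff nat_less_iff)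
  qed
  then have "card (w ` {0..N * A}) \<le> card ({..<N} \<times> {..<A})" by (intro card_mono) simp_all
  then have "card (w ` {0..N * A}) < card {0..N * A}" by (simp add: card_cartesian_product)
  then have "\<not> inj_on w {0..N * A}" by (rule pigeonhole)
  then obtain r r' where r: "r \<le> N * A" "r' \<le> N * A" "r \<noteq> r'" "w r = w r'"
    unfolding inj_on_def by auto
  define x where "x = int r - int r'"
  define s1 where "s1 = \<lfloor>real r * y1\<rfloor> - \<lfloor>real r' * y1\<rfloor>"
  have x: "x \<noteq> 0" using r by (simp add: x_def)
  have xle: "\<bar>x\<bar> \<le> int (N * A)" using r(1,2) unfolding x_def by linarith
  have "(q1 * \<lfloor>real r * y1\<rfloor> + p * int r) mod int N = (q1 * \<lfloor>real r' * y1\<rfloor> + p * int r') mod int N"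
    using r(4) N unfolding w_def by (simp add: eq_nat_nat_iff)
  then have "int N dvd (q1 * \<lfloor>real r * y1\<rfloor> + p * int r) - (q1 * \<lfloor>real r' * y1\<rfloor> + p * int r')"
    by (simp only: mod_eq_dvd_iff)
  also have "(q1 * \<lfloor>real r * y1\<rfloor> + p * int r) - (q1 * \<lfloor>real r' * y1\<rfloor> + p * int r') = q1 * s1 + p * x"
    by (simp add: s1_def x_def algebra_simps)
  finally have "q2 dvd - (q1 * s1 + p * x)" unfolding N(2) by (simp only: abs_dvd_iff dvd_minus_iff)
  then obtain s2 where s2: "- (q1 * s1 + p * x) = q2 * s2" unfolding dvd_def by blast
  define d1 where "d1 = of_int x * y1 - of_int s1"
  define d2 where "d2 = of_int x * y2 - of_int s2"
  have "nat \<lfloor>real A * frac (real r * y1)\<rfloor> = nat \<lfloor>real A * frac (real r' * y1)\<rfloor>"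
    using r(4) unfolding w_def by simp
  moreover have "0 \<le> \<lfloor>real A * frac (real r * y1)\<rfloor>" "0 \<le> \<lfloor>real A * frac (real r' * y1)\<rfloor>"
    by simp_all
  ultimately have "\<lfloor>real A * frac (real r * y1)\<rfloor> = \<lfloor>real A * frac (real r' * y1)\<rfloor>" by linarith
  then have "\<bar>real A * frac (real r * y1) - real A * frac (real r' * y1)\<bar> \<le> 1" by linarith
  moreover have "real A * frac (real r * y1) - real A * frac (real r' * y1) = real A * d1"
    by (simp add: d1_def x_def s1_def frac_def algebra_simps)
  ultimately have d1: "real A * \<bar>d1\<bar> \<le> 1" by (simp add: abs_mult)
  define L0 where "L0 = of_int q1 * y1 + of_int q2 * y2 + of_int p"
  have "of_int q2 * d2 = of_int x * L0 - of_int q1 * d1"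
  proof -
    have "real_of_int (q2 * s2) = real_of_int (- (q1 * s1 + p * x))" using s2 by simp
    then show ?thesis by (simp add: d1_def d2_def L0_def algebra_simps)
  qed
  then have "\<bar>of_int q2 * d2\<bar> \<le> \<bar>of_int x * L0\<bar> + \<bar>of_int q1 * d1\<bar>" by linarith
  then have "real N * \<bar>d2\<bar> \<le> \<bar>real_of_int x\<bar> * \<bar>L0\<bar> + \<bar>real_of_int q1\<bar> * \<bar>d1\<bar>"
    by (simp add: N(3) abs_mult)
  also have "\<dots> \<le> (real A * real N) * (\<eta> / T) + \<bar>real_of_int q1\<bar> * \<bar>d1\<bar>"
  proof -
    have "real_of_int \<bar>x\<bar> \<le> real_of_int (int (N * A))" using xle by (simp only: of_int_le_iff)
    then have "\<bar>real_of_int x\<bar> \<le> real A * real N" by (simp add: mult.commute)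
    then have "\<bar>real_of_int x\<bar> * \<bar>L0\<bar> \<le> (real A * real N) * (\<eta> / T)"
      using L unfolding L0_def[symmetric] by (intro mult_mono) auto
    then show ?thesis by simp
  qed
  \<comment> \<open>The multiplier turns the left side into
    \<open>(A * N)\<^sup>2 * \<bar>d1\<bar> * \<bar>d2\<bar>\<close>. On the right,
    \<open>A * \<bar>d1\<bar> \<le> 1\<close> removes \<open>d1\<close>, and
    \<open>A * N \<ge> T / 2\<close> converts \<open>\<eta> * T\<close> into
    \<open>(A * N)\<^sup>2 * (4 * \<eta> / T)\<close>, whence the constant 5.\<close>
  finally have "real A * \<bar>d1\<bar> * (real A * real N) * (real N * \<bar>d2\<bar>)
      \<le> real A * \<bar>d1\<bar> * (real A * real N) * ((real A * real N) * (\<eta> / T) + \<bar>real_of_int q1\<bar> * \<bar>d1\<bar>)"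
    by (intro mult_left_mono) auto
  also have "\<dots> = (real A * \<bar>d1\<bar>) * ((real A * real N)\<^sup>2 * (\<eta> / T)) + (real A * \<bar>d1\<bar>)\<^sup>2 * (\<bar>real_of_int q1\<bar> * real N)"
    by (simp add: power2_eq_square algebra_simps)
  also have "\<dots> \<le> 1 * ((real A * real N)\<^sup>2 * (\<eta> / T)) + 1 * (\<eta> * T)"
  proof (rule add_mono)
    show "(real A * \<bar>d1\<bar>) * ((real A * real N)\<^sup>2 * (\<eta> / T)) \<le> 1 * ((real A * real N)\<^sup>2 * (\<eta> / T))"
      by (rule mult_right_mono[OF d1]) (use \<eta> T in simp)
    have "(real A * \<bar>d1\<bar>)\<^sup>2 \<le> 1" using d1 by (simp add: power_le_one)
    moreover have "\<bar>real_of_int q1\<bar> * real N \<le> \<eta> * T" using q(1) N(3) by simp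
    ultimately show "(real A * \<bar>d1\<bar>)\<^sup>2 * (\<bar>real_of_int q1\<bar> * real N) \<le> 1 * (\<eta> * T)"
      by (rule mult_mono) simp_all
  qed
  also have "\<dots> \<le> (real A * real N)\<^sup>2 * (\<eta> / T) + (real A * real N)\<^sup>2 * (4 * \<eta> / T)"
  proof -
    have "(T / 2)\<^sup>2 \<le> (real A * real N)\<^sup>2" using ANge T by (intro power_mono) auto
    then have "(T / 2)\<^sup>2 * (4 * \<eta> / T) \<le> (real A * real N)\<^sup>2 * (4 * \<eta> / T)"
      using \<eta> T by (intro mult_right_mono) auto
    moreover have "(T / 2)\<^sup>2 * (4 * \<eta> / T) = \<eta> * T" using T by (simp add: power2_eq_square)
    ultimately show ?thesis by (simp only: mult_1 add_le_cancel_left)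
  qed
  also have "\<dots> = (real A * real N)\<^sup>2 * (5 * \<eta> / T)"
    by (simp only: distrib_left[symmetric] add_divide_distrib[symmetric]) simp
  finally have "(real A * real N)\<^sup>2 * (\<bar>d1\<bar> * \<bar>d2\<bar>) \<le> (real A * real N)\<^sup>2 * (5 * \<eta> / T)"
    by (simp add: power2_eq_square mult_ac)
  moreover have "0 < (real A * real N)\<^sup>2" using A0 N(1) by simp
  ultimately have "\<bar>d1\<bar> * \<bar>d2\<bar> \<le> 5 * \<eta> / T" by (simp only: mult_le_cancel_left_pos)
  moreover have "of_int \<bar>x\<bar> < T"
  proof -
    have "real_of_int \<bar>x\<bar> \<le> real_of_int (int (N * A))" using xle by (simp only: of_int_le_iff)
    then show ?thesis using ANlt by (simp add: mult.commute)
  qed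
  ultimately show ?thesis using x unfolding d1_def d2_def by blast
qed

text \<open>Apply the linear form statement at \<open>\<eta> * T\<close> with constant
  \<open>\<eta>\<^sup>2\<close>: the height is then below \<open>\<eta> * T\<close> and the form
  below \<open>\<eta> / T\<close>, as \<open>transference_nonzero\<close> requires. If
  \<open>q2 = 0\<close>, the two coordinates exchange roles.\<close>

lemma transference:
  fixes y1 y2 c :: real
  assumes c: "c > 0"
    and ev: "\<And>c. c > 0 \<Longrightarrow> \<forall>\<^sub>F k in sequentially. improvable_at c k y1 y2"
  shows "\<exists>T0>1. \<forall>T\<ge>T0. \<exists>r s1 s2 :: int. r \<noteq> 0 \<and> of_int \<bar>r\<bar> < T \<and>
    \<bar>of_int r * y1 - of_int s1\<bar> * \<bar>of_int r * y2 - of_int s2\<bar> < c / T"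
proof -
  \<comment> \<open>The bound \<open>1 / 2\<close> keeps each coordinate at most
    \<open>T / 2\<close>; the bound \<open>c / 6\<close> makes \<open>5 * \<eta>\<close> strictly
    less than \<open>c\<close>.\<close>
  define \<eta> where "\<eta> = min (1 / 2) (c / 6)"
  have \<eta>: "0 < \<eta>" "\<eta> \<le> 1 / 2" "5 * \<eta> < c" using c unfolding \<eta>_def by auto
  have "\<forall>\<^sub>F k in sequentially. improvable_at (\<eta>\<^sup>2 / 2) k y1 y2" using ev[of "\<eta>\<^sup>2 / 2"] \<eta> by simp
  then obtain T0 where T0: "T0 > 1" "\<And>T. T \<ge> T0 \<Longrightarrow> \<exists>q1 q2 p :: int. (q1 \<noteq> 0 \<or> q2 \<noteq> 0) \<and>
    of_int (max 1 \<bar>q1\<bar> * max 1 \<bar>q2\<bar>) < T \<and> \<bar>of_int q1 * y1 + of_int q2 * y2 + of_int p\<bar> < \<eta>\<^sup>2 / T"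
    using linear_form_uniform[of "\<eta>\<^sup>2" y1 y2] \<eta> by auto
  show ?thesis
  proof (rule exI[of _ "T0 / \<eta>"], intro conjI allI impI)
    show "1 < T0 / \<eta>" using T0 \<eta> by (simp add: field_simps)
    fix T assume T: "T0 / \<eta> \<le> T"
    have \<eta>T: "T0 \<le> \<eta> * T" using T \<eta> by (simp add: field_simps)
    have "0 < \<eta> * T" using \<eta>T T0 by linarith
    then have Tpos: "T > 0" using \<eta> by (simp add: zero_less_mult_iff)
    obtain q1 q2 p :: int where q: "q1 \<noteq> 0 \<or> q2 \<noteq> 0"
      "of_int (max 1 \<bar>q1\<bar> * max 1 \<bar>q2\<bar>) < \<eta> * T"
      "\<bar>of_int q1 * y1 + of_int q2 * y2 + of_int p\<bar> < \<eta>\<^sup>2 / (\<eta> * T)"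
      using T0(2)[OF \<eta>T] by blast
    have Lf: "\<eta>\<^sup>2 / (\<eta> * T) = \<eta> / T" using \<eta> by (simp add: power2_eq_square)
    have "\<bar>q1\<bar> * \<bar>q2\<bar> \<le> max 1 \<bar>q1\<bar> * max 1 \<bar>q2\<bar>" "1 * \<bar>q2\<bar> \<le> max 1 \<bar>q1\<bar> * max 1 \<bar>q2\<bar>"
      "\<bar>q1\<bar> * 1 \<le> max 1 \<bar>q1\<bar> * max 1 \<bar>q2\<bar>"
      by (intro mult_mono; simp)+
    then have "real_of_int (\<bar>q1\<bar> * \<bar>q2\<bar>) \<le> real_of_int (max 1 \<bar>q1\<bar> * max 1 \<bar>q2\<bar>)"
      "real_of_int \<bar>q2\<bar> \<le> real_of_int (max 1 \<bar>q1\<bar> * max 1 \<bar>q2\<bar>)"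
      "real_of_int \<bar>q1\<bar> \<le> real_of_int (max 1 \<bar>q1\<bar> * max 1 \<bar>q2\<bar>)"
      by (simp_all only: of_int_le_iff mult_1 mult_1_right)
    note le0 = this[THEN order.trans, OF less_imp_le[OF q(2)]]
    have half: "\<eta> * T \<le> T / 2" using \<eta>(2) Tpos by simp
    have le: "real_of_int (\<bar>q1\<bar> * \<bar>q2\<bar>) \<le> \<eta> * T" "real_of_int \<bar>q2\<bar> \<le> T / 2"
      "real_of_int \<bar>q1\<bar> \<le> T / 2" "real_of_int (\<bar>q2\<bar> * \<bar>q1\<bar>) \<le> \<eta> * T"
      using le0 order.trans[OF le0(2) half] order.trans[OF le0(3) half]
      by (simp_all only: mult.commute)
    have "\<exists>r s1 s2 :: int. r \<noteq> 0 \<and> of_int \<bar>r\<bar> < T \<and>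
      \<bar>of_int r * y1 - of_int s1\<bar> * \<bar>of_int r * y2 - of_int s2\<bar> \<le> 5 * \<eta> / T"
    proof (cases "q2 = 0")
      case False
      show ?thesis
        by (rule transference_nonzero[OF False _ Tpos le(1,2), where p = p]) (use q(3) \<eta> Lf in simp_all)
    next
      case True
      have "\<exists>r s1 s2 :: int. r \<noteq> 0 \<and> of_int \<bar>r\<bar> < T \<and>
        \<bar>of_int r * y2 - of_int s1\<bar> * \<bar>of_int r * y1 - of_int s2\<bar> \<le> 5 * \<eta> / T"
        by (rule transference_nonzero[OF _ _ Tpos le(4,3), where p = p]) (use q True \<eta> Lf in simp_all)
      then show ?thesis unfolding mult.commute[of "\<bar>_ * y2 - _\<bar>"] by blast
    qed
    moreover have "5 * \<eta> / T < c / T" using \<eta> Tpos by (simp add: divide_strict_right_mono)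
    ultimately show "\<exists>r s1 s2 :: int. r \<noteq> 0 \<and> of_int \<bar>r\<bar> < T \<and>
      \<bar>of_int r * y1 - of_int s1\<bar> * \<bar>of_int r * y2 - of_int s2\<bar> < c / T"
      by (meson order.strict_trans1)
  qed
qed

section \<open>From pairs of entries to matrices\<close>

text \<open>A measurable planar null set \<open>N\<close> covers the failures of \<open>P\<close>.
  As \<open>lborel\<close> is the image of a product measure over \<open>Basis\<close>, splitting
  off \<open>b1\<close> and \<open>b2\<close> makes the planar measure of \<open>N\<close> an inner
  factor, so the preimage of \<open>N\<close> is null.\<close>

lemma AE_lborel_two_coordinates:
  fixes b1 b2 :: "'a :: euclidean_space"
  assumes b: "b1 \<in> Basis" "b2 \<in> Basis" "b1 \<noteq> b2"
    and P: "AE y in (lborel :: (real \<times> real) measure). P (fst y) (snd y)"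
  shows "AE x in (lborel :: 'a measure). P (x \<bullet> b1) (x \<bullet> b2)"
proof -
  obtain N where N: "N \<in> null_sets lborel" "{y. \<not> P (fst y) (snd y)} \<subseteq> N"
    using P unfolding eventually_ae_filter by auto
  have "N \<in> sets lborel" using N(1) by auto
  then have Ns[measurable]: "N \<in> sets (borel \<Otimes>\<^sub>M borel)" by (simp only: borel_prod sets_lborel)
  interpret product_sigma_finite "\<lambda>_::'a. lborel :: real measure" by standard
  define J where "J = (Basis :: 'a set) - {b1, b2}"
  have J: "finite J" "b2 \<notin> J" "b1 \<notin> insert b2 J" "insert b1 (insert b2 J) = (Basis :: 'a set)"
    using b by (auto simp: J_def)
  define M where "M = (\<lambda>I::'a set. Pi\<^sub>M I (\<lambda>_. lborel :: real measure))"
  have slice: "(\<integral>\<^sup>+y2. \<integral>\<^sup>+y1. indicator N (y1, y2) \<partial>lborel \<partial>lborel) = (0 :: ennreal)"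
  proof -
    have "(\<integral>\<^sup>+y2. \<integral>\<^sup>+y1. indicator N (y1, y2) \<partial>lborel \<partial>lborel)
        = (\<integral>\<^sup>+y. indicator N y \<partial>(lborel \<Otimes>\<^sub>M lborel))"
      by (rule lborel_pair.nn_integral_snd) measurable
    also have "\<dots> = 0" using N(1) by (simp add: lborel_prod nn_integral_indicator null_sets_def)
    finally show ?thesis .
  qed
  have "(\<integral>\<^sup>+x. indicator N (x \<bullet> b1, x \<bullet> b2) \<partial>(lborel :: 'a measure))
      = (\<integral>\<^sup>+f. indicator N (f b1, f b2) \<partial>M Basis)"
    unfolding M_def using b
    by (subst lborel_eq, subst nn_integral_distr) (auto simp: inner_sum_left_Basis)
  also have "\<dots> = (\<integral>\<^sup>+f. \<integral>\<^sup>+y1. indicator N (y1, f b2) \<partial>lborel \<partial>M (insert b2 J))"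
    unfolding M_def J(4)[symmetric] using J b
    by (subst product_nn_integral_insert) (auto simp del: J(4))
  also have "\<dots> = (\<integral>\<^sup>+f. \<integral>\<^sup>+y2. \<integral>\<^sup>+y1. indicator N (y1, y2) \<partial>lborel \<partial>lborel \<partial>M J)"
    unfolding M_def using J b
    by (subst product_nn_integral_insert) auto
  also have "\<dots> = 0" unfolding slice by simp
  finally have "(\<integral>\<^sup>+x. indicator N (x \<bullet> b1, x \<bullet> b2) \<partial>(lborel :: 'a measure)) = 0" .
  then have "AE x in (lborel :: 'a measure). indicator N (x \<bullet> b1, x \<bullet> b2) = (0 :: ennreal)"
    by (subst (asm) nn_integral_0_iff_AE) auto
  then show ?thesis
    by eventually_elim (use N(2) in \<open>auto simp: subset_eq indicator_def split: if_splits\<close>)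
qed

lemma prod_UNIV_le_prod_subset:
  fixes f :: "'a::finite \<Rightarrow> real"
  assumes "\<And>i. 0 \<le> f i" "\<And>i. i \<notin> S \<Longrightarrow> f i \<le> 1"
  shows "prod f UNIV \<le> prod f S"
proof -
  have "prod f UNIV = prod f (UNIV - S) * prod f S" by (rule prod.subset_diff) simp_all
  also have "\<dots> \<le> 1 * prod f S"
    using assms by (intro mult_right_mono prod_le_1 prod_nonneg) auto
  finally show ?thesis by simp
qed

lemma inner_axis_axis:
  fixes Y :: "real^'n^'m"
  shows "Y \<bullet> axis i (axis j 1) = Y $ i $ j"
  by (simp add: inner_axis)

lemma D_mult_of_two_columns:
  fixes Y :: "real^'n::finite^'m::finite"
  assumes j: "j1 \<noteq> j2" and c: "c > 0"
    and ev: "\<forall>\<^sub>F k in sequentially. improvable_at (c / 2) k (Y $ i $ j1) (Y $ i $ j2)"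
  shows "Y \<in> D_mult (\<lambda>x. c * psi1 x)"
proof -
  obtain T0 where T0: "T0 > 1" "\<And>T. T \<ge> T0 \<Longrightarrow> \<exists>q1 q2 p :: int. (q1 \<noteq> 0 \<or> q2 \<noteq> 0) \<and>
    of_int (max 1 \<bar>q1\<bar> * max 1 \<bar>q2\<bar>) < T \<and>
    \<bar>of_int q1 * Y $ i $ j1 + of_int q2 * Y $ i $ j2 + of_int p\<bar> < c / T"
    using linear_form_uniform[OF ev c] by meson
  have "Y \<in> S_mult (\<lambda>x. c * psi1 x) T" if T: "T \<ge> T0" for T
  proof -
    obtain q1 q2 p :: int where q: "q1 \<noteq> 0 \<or> q2 \<noteq> 0" "of_int (max 1 \<bar>q1\<bar> * max 1 \<bar>q2\<bar>) < T"
      "\<bar>of_int q1 * Y $ i $ j1 + of_int q2 * Y $ i $ j2 + of_int p\<bar> < c / T"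
      using T0(2)[OF T] by meson
    define Q :: "real^'n" where "Q = (\<chi> j. if j = j1 then of_int q1 else if j = j2 then of_int q2 else 0)"
    \<comment> \<open>Nearest integers in the other rows keep their factors at most 1, so the
      product is controlled by row \<open>i\<close> alone.\<close>
    define P :: "real^'m" where "P = (\<chi> l. if l = i then - of_int p else of_int (round (Y $ l \<bullet> Q)))"
    have YQ: "Y $ i \<bullet> Q = of_int q1 * Y $ i $ j1 + of_int q2 * Y $ i $ j2"
    proof -
      have "Y $ i \<bullet> Q = (\<Sum>j\<in>UNIV. Y $ i $ j * Q $ j)" by (simp add: inner_vec_def)
      also have "\<dots> = (\<Sum>j\<in>{j1, j2}. Y $ i $ j * Q $ j)"
        by (rule sum.mono_neutral_right) (auto simp: Q_def)
      also have "\<dots> = of_int q1 * Y $ i $ j1 + of_int q2 * Y $ i $ j2"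
        using j by (simp add: Q_def)
      finally show ?thesis .
    qed
    have "Pi_plus Q = (\<Prod>j\<in>{j1, j2}. max 1 \<bar>Q $ j\<bar>)"
      unfolding Pi_plus_def by (rule prod.mono_neutral_right) (auto simp: Q_def)
    also have "\<dots> = of_int (max 1 \<bar>q1\<bar> * max 1 \<bar>q2\<bar>)"
      using j by (simp add: Q_def of_int_max)
    finally have PQ: "Pi_plus Q < T" using q(2) by simp
    have "(\<Prod>l\<in>UNIV. \<bar>Y $ l \<bullet> Q - P $ l\<bar>) \<le> (\<Prod>l\<in>{i}. \<bar>Y $ l \<bullet> Q - P $ l\<bar>)"
    proof (rule prod_UNIV_le_prod_subset)
      fix l assume "l \<notin> {i}"
      then show "\<bar>Y $ l \<bullet> Q - P $ l\<bar> \<le> 1"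
        using of_int_round_abs_le[of "Y $ l \<bullet> Q"] by (simp add: P_def abs_minus_commute)
    qed simp
    also have "\<dots> < c * psi1 T" using q(3) by (simp add: P_def YQ psi1_def)
    finally have small: "(\<Prod>l\<in>UNIV. \<bar>Y $ l \<bullet> Q - P $ l\<bar>) < c * psi1 T" .
    have "Q $ j1 \<noteq> 0 \<or> Q $ j2 \<noteq> 0" using q(1) j by (simp add: Q_def)
    then have "Q \<noteq> 0" by auto
    moreover have "\<forall>l. P $ l \<in> \<int>" "\<forall>l. Q $ l \<in> \<int>" by (simp_all add: P_def Q_def)
    ultimately show ?thesis using small PQ unfolding S_mult_def by blast
  qed
  then show ?thesis using T0(1) unfolding D_mult_def by auto
qed

lemma D_mult_of_two_rows:
  fixes Y :: "real^'n::finite^'m::finite"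
  assumes i: "i1 \<noteq> i2" and c: "c > 0"
    and ev: "\<And>c. c > 0 \<Longrightarrow> \<forall>\<^sub>F k in sequentially. improvable_at c k (Y $ i1 $ j) (Y $ i2 $ j)"
  shows "Y \<in> D_mult (\<lambda>x. c * psi1 x)"
proof -
  obtain T0 where T0: "T0 > 1" "\<And>T. T \<ge> T0 \<Longrightarrow> \<exists>r s1 s2 :: int. r \<noteq> 0 \<and> of_int \<bar>r\<bar> < T \<and>
    \<bar>of_int r * Y $ i1 $ j - of_int s1\<bar> * \<bar>of_int r * Y $ i2 $ j - of_int s2\<bar> < c / T"
    using transference[OF c ev] by meson
  have "Y \<in> S_mult (\<lambda>x. c * psi1 x) T" if T: "T \<ge> T0" for T
  proof -
    obtain r s1 s2 :: int where r: "r \<noteq> 0" "of_int \<bar>r\<bar> < T"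
      "\<bar>of_int r * Y $ i1 $ j - of_int s1\<bar> * \<bar>of_int r * Y $ i2 $ j - of_int s2\<bar> < c / T"
      using T0(2)[OF T] by meson
    define Q :: "real^'n" where "Q = axis j (of_int r)"
    \<comment> \<open>Rows \<open>i1\<close> and \<open>i2\<close> receive the simultaneous
      approximation; rounding makes every other factor at most 1.\<close>
    define P :: "real^'m" where "P = (\<chi> l. if l = i1 then of_int s1 else if l = i2 then of_int s2
      else of_int (round (Y $ l \<bullet> Q)))"
    have YQ: "Y $ l \<bullet> Q = of_int r * Y $ l $ j" for l by (simp add: Q_def inner_axis)
    have "Pi_plus Q = (\<Prod>l\<in>{j}. max 1 \<bar>Q $ l\<bar>)"
      unfolding Pi_plus_def by (rule prod.mono_neutral_right) (auto simp: Q_def axis_def)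
    then have PQ: "Pi_plus Q < T" using r(2) T T0(1) by (simp add: Q_def)
    have "(\<Prod>l\<in>UNIV. \<bar>Y $ l \<bullet> Q - P $ l\<bar>) \<le> (\<Prod>l\<in>{i1, i2}. \<bar>Y $ l \<bullet> Q - P $ l\<bar>)"
    proof (rule prod_UNIV_le_prod_subset)
      fix l assume "l \<notin> {i1, i2}"
      then show "\<bar>Y $ l \<bullet> Q - P $ l\<bar> \<le> 1"
        using of_int_round_abs_le[of "Y $ l \<bullet> Q"] by (simp add: P_def abs_minus_commute)
    qed simp
    also have "\<dots> < c * psi1 T" using r(3) i by (simp add: P_def YQ psi1_def)
    finally have small: "(\<Prod>l\<in>UNIV. \<bar>Y $ l \<bullet> Q - P $ l\<bar>) < c * psi1 T" .
    have "Q \<noteq> 0" using r(1) by (simp add: Q_def axis_eq_0_iff)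
    moreover have "\<forall>l. P $ l \<in> \<int>" "\<forall>l. Q $ l \<in> \<int>" by (simp_all add: P_def Q_def axis_def)
    ultimately show ?thesis using small PQ unfolding S_mult_def by blast
  qed
  then show ?thesis using T0(1) unfolding D_mult_def by auto
qed

lemma AE_D_mult:
  assumes "CARD('m::finite) > 1 \<or> CARD('n::finite) > 1"
  shows "AE Y in (lborel :: (real^'n^'m) measure). \<forall>c>0. Y \<in> D_mult (\<lambda>x. c * psi1 x)"
proof -
  have two: "\<exists>a b :: 'a. a \<noteq> b" if "CARD('a::finite) > 1"
    using that by (metis card_le_Suc0_iff_eq finite_class.finite_UNIV UNIV_I One_nat_def not_less)
  have coords: "AE Y in (lborel :: (real^'n^'m) measure).
      \<forall>c>0. \<forall>\<^sub>F k in sequentially. improvable_at c k (Y $ i1 $ j1) (Y $ i2 $ j2)"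
    if "i1 \<noteq> i2 \<or> j1 \<noteq> j2" for i1 i2 j1 j2
    using AE_lborel_two_coordinates[of "axis i1 (axis j1 1) :: real^'n^'m" "axis i2 (axis j2 1)"
        "\<lambda>y1 y2. \<forall>c>0. \<forall>\<^sub>F k in sequentially. improvable_at c k y1 y2", OF _ _ _ AE_improvable_at] that
    by (auto simp: inner_axis_axis axis_eq_axis axis_in_Basis_iff)
  from assms show ?thesis
  proof
    assume "CARD('m) > 1"
    then obtain i1 i2 :: 'm where i: "i1 \<noteq> i2" using two by blast
    \<comment> \<open>Here \<open>undefined\<close> is just some fixed column; index types are
      nonempty but may have a single element.\<close>
    from coords[of i1 i2 undefined undefined] i have
      "AE Y in (lborel :: (real^'n^'m) measure).
        \<forall>c>0. \<forall>\<^sub>F k in sequentially. improvable_at c k (Y $ i1 $ undefined) (Y $ i2 $ undefined)" by simp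
    then show ?thesis
      by (rule AE_mp) (intro AE_I2 impI allI D_mult_of_two_rows[OF i, where j = undefined], simp_all)
  next
    assume "CARD('n) > 1"
    then obtain j1 j2 :: 'n where j: "j1 \<noteq> j2" using two by blast
    from coords[of undefined undefined j1 j2] j have
      "AE Y in (lborel :: (real^'n^'m) measure).
        \<forall>c>0. \<forall>\<^sub>F k in sequentially. improvable_at c k (Y $ undefined $ j1) (Y $ undefined $ j2)" by simp
    then show ?thesis
      by (rule AE_mp) (intro AE_I2 impI allI D_mult_of_two_columns[OF j, where i = undefined], simp_all)
  qed
qed

theorem mainTheorem4:
  assumes "CARD('m::finite) > 1 \<or> CARD('n::finite) > 1"
  shows "(\<forall>c::real. c > 0 \<longrightarrow>
            UNIV - (D_mult (\<lambda>x. c * psi1 x) :: (real^'n^'m) set) \<in> null_sets lebesgue)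
         \<and> UNIV - (Sing_mult :: (real^'n^'m) set) \<in> null_sets lebesgue"
proof -
  obtain N where N: "N \<in> null_sets lborel"
    "{Y :: real^'n^'m. \<not> (\<forall>c>0. Y \<in> D_mult (\<lambda>x. c * psi1 x))} \<subseteq> N"
    using AE_D_mult[OF assms] unfolding eventually_ae_filter by auto
  \<comment> \<open>Completeness of Lebesgue measure supplies the measurability of the complements.
    A single null set for all \<open>c\<close> handles the uncountable intersection in
    \<open>Sing_mult\<close>.\<close>
  have null: "X \<in> null_sets lebesgue"
    if "X \<subseteq> {Y :: real^'n^'m. \<not> (\<forall>c>0. Y \<in> D_mult (\<lambda>x. c * psi1 x))}" for X
    using null_sets_completion_subset[OF order.trans[OF that N(2)] null_sets_completionI[OF N(1)]] .
  have "UNIV - (D_mult (\<lambda>x. c * psi1 x) :: (real^'n^'m) set) \<in> null_sets lebesgue" if "c > 0" for c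
    by (rule null) (use that in auto)
  moreover have "UNIV - (Sing_mult :: (real^'n^'m) set) \<in> null_sets lebesgue"
    by (rule null) (auto simp: Sing_mult_def)
  ultimately show ?thesis by blast
qed

end
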